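(* Let $I=[a,b]$ be a compact interval, $g\in\operatorname{CV}_-(I,\mathbb R)$ and let $c\in\operatorname{L}^1_g([a,b))$ be such that $$1+c(t)[g(t^+)-g(t)]>0\ \text{ for all } t\in[a,b)\cap D_g\quad\text{and}\quad \sum_{t\in[a,b)\cap D_g}\big|\ln\big(1+c(t)[g(t^+)-g(t)]\big)\big|<\infty .$$ Let $e_{g,c,a}$ be the $g$-exponential of $c$ on $I$. Then $x=e_{g,c,a}$ solves the initial value problem $$x'_g(t)=c(t)x(t)\quad |\mu_g|\text{-a.e. } t\in I,\qquad x(a)=1 .$$ Furthermore, $$e_{g,c,a}(t)=1+\int_{[a,t)}c(s)\,e_{g,c,a}(s)\,\mathrm d\mu_g\quad\text{for every } t\in I .$$
   Context: For an interval $J\subset I$, $\operatorname{var}_gJ$ is the total variation of $g$ on $J$, and $\operatorname{var}_g^{\pm}J=\sup\sum_j[g(x_{j+1})-g(x_j)]^{\pm}$ over finite nondecreasing sequences in $J$, where $c^+=\max\{c,0\}$, $c^-=-\min\{c,0\}$ for a real number $c$. $\operatorname{BV}_-(I,\mathbb R)$ is the set of left continuous functions on $I$ of bounded variation. One-sided limits are denoted $g(x^\pm)$, with $g(a^-):=g(a)$, $g(b^+):=g(b)$. $D_g=\{x\in I:g(x^+)\ne g(x^-)\}$. $C_g$ is the set of $x\in I$ such that $g$ is constant on a neighbourhood of $x$, and $\overline{C_g}$ is its closure. For $g\in\operatorname{BV}_-(I,\mathbb R)$, $|\mu_g|$ is the measure with $|\mu_g|([x,y))=\operatorname{var}_g[x,y)$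 and $|\mu_g|(\{x\})=|g(x^+)-g(x)|$; $\mu_g^{\pm}$ are constructed in the same way from $\operatorname{var}_g^{\pm}$, and $\mu_g:=\mu_g^+-\mu_g^-$. $\operatorname{L}^1_g(J)$ is the space of real functions on $J$ that are $|\mu_g|$-integrable on $J$. $\operatorname{CV}_-(I,\mathbb R)$ is the set of $g\in\operatorname{BV}_-(I,\mathbb R)$ for which there is a closed set $F_g\subset I$ such that $g$ is monotonic on each connected component of $I\setminus F_g$ and $|\mu_g|(F_g\setminus D_g)=0$; $F_g$ is fixed and assumed to satisfy $F_g\subset I\setminus C_g$. The $g$-derivative of $f:I\to\mathbb R$ is defined at points $x\in D_g\cup\big(I\setminus(F_g\cup\overline{C_g})\big)$ and is, provided the limit exists, $f'_g(x)=\lim_{y\to x}\frac{f(y)-f(x)}{g(y)-g(x)}$ if $x\notin D_g$ and $f'_g(x)=\lim_{y\to x^+}\frac{f(y)-f(x)}{g(y)-g(x)}$ if $x\in D_g$. For $c$ as in the claim, the $g$-exponential of $c$ on $I$ is $e_{g,c,a}:I\to(0,\infty)$, $e_{g,c,a}(t):=e^{\int_{[a,t)}\widetilde c(s)\,\mathrm d\mu_g}$, where $\widetilde c(t)=c(t)$ if $t\in I\setminus D_g$ and $\widetilde c(t)=\frac{\ln(1+c(t)(g(t^+)-g(t)))}{g(t^+)-g(t)}$ if $t\in I\cap D_g$.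
   Formalization: The closure of C_g minus D_g, where the g-derivative is undefined, can have positive |μ_g|-measure (fat Cantor set). There the a.e. equation is stated for the limit of the difference quotient; elsewhere for the g-derivative itself. *)

theory Defs
  imports "HOL-Analysis.Analysis"
begin

text \<open>
  Throughout, the interval is \<open>I = {a..b}\<close>, and functions on \<open>I\<close> (or on a part of it) are total
  functions on the reals of which only the values on \<open>I\<close> (or on that part) are used.
\<close>

definition pos_part :: "real \<Rightarrow> real"
  where "pos_part u = max u 0"

definition neg_part :: "real \<Rightarrow> real"
  where "neg_part u = - min u 0"

text \<open>
  The weight \<open>w\<close> is \<open>abs\<close>, \<open>pos_part\<close> or \<open>neg_part\<close>, and yields the total, positive and negative
  variation respectively.
\<close>

definition variation_on :: "(real \<Rightarrow> real) \<Rightarrow> (real \<Rightarrow> real) \<Rightarrow> real set \<Rightarrow> ennreal"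
  where "variation_on w g J =
    Sup {(\<Sum>j<n. ennreal (w (g (x (Suc j)) - g (x j)))) | (n :: nat) (x :: nat \<Rightarrow> real).
           (\<forall>j\<le>n. x j \<in> J) \<and> (\<forall>j<n. x j \<le> x (Suc j))}"

definition left_lim :: "real \<Rightarrow> (real \<Rightarrow> real) \<Rightarrow> real \<Rightarrow> real"
  where "left_lim a g x = (if a < x then Lim (at_left x) g else g a)"

definition right_lim :: "real \<Rightarrow> (real \<Rightarrow> real) \<Rightarrow> real \<Rightarrow> real"
  where "right_lim b g x = (if x < b then Lim (at_right x) g else g b)"

definition BV_minus :: "real \<Rightarrow> real \<Rightarrow> (real \<Rightarrow> real) set"
  where "BV_minus a b =
    {g. variation_on abs g {a..b} < \<infinity> \<and> (\<forall>x\<in>{a<..b}. (g \<longlongrightarrow> g x) (at_left x))}"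

definition disc_set :: "real \<Rightarrow> real \<Rightarrow> (real \<Rightarrow> real) \<Rightarrow> real set"
  where "disc_set a b g = {x\<in>{a..b}. right_lim b g x \<noteq> left_lim a g x}"

definition const_set :: "real \<Rightarrow> real \<Rightarrow> (real \<Rightarrow> real) \<Rightarrow> real set"
  where "const_set a b g =
    {x\<in>{a..b}. \<exists>U. openin (top_of_set {a..b}) U \<and> x \<in> U \<and> g constant_on U}"

text \<open>
  The (complete) Lebesgue--Stieltjes measures on \<open>I\<close>: \<open>w = abs\<close>, \<open>pos_part\<close>, \<open>neg_part\<close> give
  \<open>|\<mu>\<^sub>g|\<close>, \<open>\<mu>\<^sub>g\<^sup>+\<close>, \<open>\<mu>\<^sub>g\<^sup>-\<close>. The prescribed sets are the intervals \<open>[x, y)\<close> (indexed by \<open>Inl (x, y)\<close>)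
  and the singletons \<open>{x}\<close> (indexed by \<open>Inr x\<close>); they generate the Borel sets of \<open>I\<close>.
\<close>

definition stieltjes_measure ::
    "(real \<Rightarrow> real) \<Rightarrow> real \<Rightarrow> real \<Rightarrow> (real \<Rightarrow> real) \<Rightarrow> real measure"
  where "stieltjes_measure w a b g = completion
    (extend_measure {a..b}
       ({(x, y). a \<le> x \<and> x \<le> y \<and> y \<le> b} <+> {a..b})
       (case_sum (\<lambda>(x, y). {x..<y}) (\<lambda>x. {x}))
       (case_sum (\<lambda>(x, y). variation_on w g {x..<y})
                 (\<lambda>x. ennreal (w (right_lim b g x - g x)))))"

abbreviation "abs_measure \<equiv> stieltjes_measure abs"

definition g_integrable_on :: "real \<Rightarrow> real \<Rightarrow> (real \<Rightarrow> real) \<Rightarrow> (real \<Rightarrow> real) \<Rightarrow> real set \<Rightarrow> bool"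
  where "g_integrable_on a b g f A \<longleftrightarrow> set_integrable (abs_measure a b g) A f"

text \<open>The integral with respect to the signed measure \<open>\<mu>\<^sub>g = \<mu>\<^sub>g\<^sup>+ - \<mu>\<^sub>g\<^sup>-\<close>.\<close>

definition g_integral :: "real \<Rightarrow> real \<Rightarrow> (real \<Rightarrow> real) \<Rightarrow> real set \<Rightarrow> (real \<Rightarrow> real) \<Rightarrow> real"
  where "g_integral a b g A f =
    set_lebesgue_integral (stieltjes_measure pos_part a b g) A f
    - set_lebesgue_integral (stieltjes_measure neg_part a b g) A f"

definition CV_witness :: "real \<Rightarrow> real \<Rightarrow> (real \<Rightarrow> real) \<Rightarrow> real set \<Rightarrow> bool"
  where "CV_witness a b g F \<longleftrightarrow>
    closed F \<and> F \<subseteq> {a..b} \<and>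
    (\<forall>K\<in>components ({a..b} - F). mono_on K g \<or> antimono_on K g) \<and>
    F - disc_set a b g \<in> null_sets (abs_measure a b g)"

definition CV_minus :: "real \<Rightarrow> real \<Rightarrow> (real \<Rightarrow> real) set"
  where "CV_minus a b = {g \<in> BV_minus a b. \<exists>F. CV_witness a b g F}"

text \<open>
  The limit of difference quotients, from the right at points of \<open>D\<^sub>g\<close> and within \<open>I\<close> at all other
  points. The requirement that the quotient be defined near \<open>x\<close> keeps HOL's \<open>u / 0 = 0\<close> from
  contributing to the limit. For \<open>g\<close> in \<open>CV_minus a b\<close> with witness \<open>F\<close>, it holds automatically on
  \<open>g_derivative_domain a b g F\<close>.
\<close>

definition g_quotient_limit ::
    "real \<Rightarrow> real \<Rightarrow> (real \<Rightarrow> real) \<Rightarrow> (real \<Rightarrow> real) \<Rightarrow> real \<Rightarrow> real \<Rightarrow> bool"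
  where "g_quotient_limit a b g f d x \<longleftrightarrow>
    (let L = (if x \<in> disc_set a b g then at x within {x<..b} else at x within {a..b}) in
       (\<forall>\<^sub>F y in L. g y \<noteq> g x) \<and> ((\<lambda>y. (f y - f x) / (g y - g x)) \<longlongrightarrow> d) L)"

definition g_derivative_domain :: "real \<Rightarrow> real \<Rightarrow> (real \<Rightarrow> real) \<Rightarrow> real set \<Rightarrow> real set"
  where "g_derivative_domain a b g F =
    disc_set a b g \<union> ({a..b} - (F \<union> closure (const_set a b g)))"

text \<open>
  \<open>f\<close> has \<open>g\<close>-derivative \<open>d\<close> at \<open>x\<close>. The set \<open>closure C\<^sub>g - D\<^sub>g\<close>, which is excluded from the domain, need
  not be \<open>|\<mu>\<^sub>g|\<close>-null: if \<open>g t\<close> is the Lebesgue measure of \<open>K \<inter> {0..t}\<close> for a fat Cantor set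
  \<open>K \<subseteq> {0..1}\<close>, then \<open>D\<^sub>g\<close> is empty and \<open>C\<^sub>g\<close> is dense, so the domain is empty although \<open>|\<mu>\<^sub>g|\<close> is not
  zero. Statements about the limit itself at such points are therefore made by \<open>g_quotient_limit\<close>.
\<close>

definition has_g_derivative ::
    "real \<Rightarrow> real \<Rightarrow> (real \<Rightarrow> real) \<Rightarrow> real set \<Rightarrow> (real \<Rightarrow> real) \<Rightarrow> real \<Rightarrow> real \<Rightarrow> bool"
  where "has_g_derivative a b g F f d x \<longleftrightarrow>
    x \<in> g_derivative_domain a b g F \<and> g_quotient_limit a b g f d x"

definition exp_coeff :: "real \<Rightarrow> real \<Rightarrow> (real \<Rightarrow> real) \<Rightarrow> (real \<Rightarrow> real) \<Rightarrow> real \<Rightarrow> real"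
  where "exp_coeff a b g c t =
    (if t \<in> disc_set a b g
     then ln (1 + c t * (right_lim b g t - g t)) / (right_lim b g t - g t)
     else c t)"

definition g_exp :: "real \<Rightarrow> real \<Rightarrow> (real \<Rightarrow> real) \<Rightarrow> (real \<Rightarrow> real) \<Rightarrow> real \<Rightarrow> real"
  where "g_exp a b g c t = exp (g_integral a b g {a..<t} (exp_coeff a b g c))"

end

theory Submission
  imports Defs
begin

text \<open>
  Write \<open>\<mu>\<close> for \<open>|\<mu>\<^sub>g|\<close>, \<open>D\<close> for \<open>D\<^sub>g\<close> and \<open>E\<close> for the \<open>g\<close>-exponential. The proof first reduces the statement
  to a single finite Borel measure on the line. For each of the three weights, the variation
  between two points is the supremum of the sums over chains that start in one point and end in the
  other. It is additive and left continuous, and its right jump at \<open>x\<close> is the weight of the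
  right jump of \<open>g\<close> (\<open>var_add\<close>, \<open>var_left_tendsto\<close>, \<open>var_right_tendsto\<close>). It therefore is the
  distribution function of a finite Borel measure, of which the prescribed Stieltjes measure is the
  completion on \<open>I\<close> (\<open>stieltjes_measure_eq\<close>). Total variation is the sum of positive and negative
  variation, so by Radon--Nikodym \<open>d\<mu>\<^sub>g = \<sigma> d\<mu>\<close> with \<open>|\<sigma>| \<le> 1\<close> (\<open>stieltjes_signed_density\<close>).

  The integral equation does not mention \<open>g\<close> any more. It concerns the densities
  \<open>k = exp_coeff \<cdot> \<sigma>\<close> and \<open>h = c \<sigma>\<close>, which agree off the countable set \<open>D\<close> and satisfy
  \<open>exp (k x \<mu>{x}) - 1 = h x \<mu>{x}\<close> at every point; the logarithm in \<open>exp_coeff\<close> is chosen for this. Over a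
  short interval without large atoms, the increment of \<open>E = exp (\<integral> k d\<mu>)\<close> differs from the integral of
  \<open>h E\<close> by a term of second order in the mass of the interval and a multiple of the mass of its atoms; at
  a large atom the two agree exactly. Adding up gives equality (\<open>exponential_integral_equation\<close>).

  For the derivative, the integral equation makes \<open>E\<close> and \<open>g\<close> indefinite integrals, of \<open>h E\<close> and of
  \<open>\<sigma>\<close>, with respect to the same measure \<open>\<mu>\<close>. At an atom the quotient converges to the quotient of the
  two jumps. At \<open>\<mu>\<close>-almost every other point, the averages of \<open>h E\<close> and of \<open>\<sigma>\<close> over intervals with one
  endpoint at the point converge to the values there (\<open>AE_average_tendsto\<close>). Almost every such
  point has an open neighbourhood outside \<open>F\<close> on which \<open>g\<close> is monotonic, whence
  \<open>\<mu> [x, y) = |g y - g x|\<close>. This forces \<open>|\<sigma>| = 1\<close> there and the difference quotient converges to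
  \<open>h E / \<sigma> = c E\<close>. That \<open>g y \<noteq> g x\<close> for \<open>y\<close> near \<open>x\<close> holds almost everywhere because the points that
  are endpoints of \<open>\<mu>\<close>-null intervals form, up to atoms, a null set (\<open>AE_measure_interval_pos\<close>); so the
  limit exists at almost every point of \<open>closure C\<^sub>g\<close> as well.
\<close>

section \<open>Integrals against a finite Borel measure\<close>

lemma integrable_imp_set_integrable:
  fixes f :: "'a \<Rightarrow> real"
  assumes "integrable M f" "S \<in> sets M"
  shows "set_integrable M S f"
  using integrable_mult_indicator[OF assms(2,1)] by (simp add: set_integrable_def)

lemma finite_measure_density_real:
  fixes q :: "'a \<Rightarrow> real"
  assumes q: "integrable M q" "\<And>x. 0 \<le> q x"
  shows "finite_measure (density M q)"
    and "S \<in> sets M \<Longrightarrow> measure (density M q) S = (LINT x:S|M. q x)"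
proof -
  have [measurable]: "q \<in> borel_measurable M" using q by auto
  show "finite_measure (density M q)"
  proof
    have "emeasure (density M q) (space (density M q)) = (\<integral>\<^sup>+x. ennreal (q x) \<partial>M)"
      by (subst emeasure_density) (auto intro!: nn_integral_cong)
    also have "\<dots> < \<infinity>" using q by (subst nn_integral_eq_integral) auto
    finally show "emeasure (density M q) (space (density M q)) \<noteq> \<infinity>" by simp
  qed
  assume [measurable]: "S \<in> sets M"
  have "emeasure (density M q) S = (\<integral>\<^sup>+x. ennreal (indicator S x * q x) \<partial>M)"
    by (subst emeasure_density) (auto intro!: nn_integral_cong simp: indicator_def)
  also have "\<dots> = ennreal (LINT x:S|M. q x)"
    using integrable_imp_set_integrable[OF q(1) \<open>S \<in> sets M\<close>] q(2)
    by (subst nn_integral_eq_integral) (auto simp: set_integrable_def set_lebesgue_integral_def)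
  finally show "measure (density M q) S = (LINT x:S|M. q x)"
    using q(2) by (simp add: measure_def set_lebesgue_integral_def integral_nonneg_AE)
qed

lemma integral_singleton:
  fixes f :: "real \<Rightarrow> real"
  assumes "sets N = sets borel"
  shows "(LINT s:{x}|N. f s) = f x * measure N {x}"
proof -
  have "(LINT s:{x}|N. f s) = (LINT s:{x}|N. f x)" using assms by (intro set_lebesgue_integral_cong) auto
  then show ?thesis using sets_eq_imp_space_eq[OF assms] by (simp add: set_lebesgue_integral_def mult.commute)
qed

section \<open>Differentiation of a measure on the line along one-sided intervals\<close>

text \<open>
  If three intervals share a point, then the one that starts first and the one that ends last cover the
  third. Discarding such superfluous intervals leaves a subcover in which no point is covered more than
  twice. On the line this replaces a Vitali covering lemma and needs no doubling property of the measure.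
\<close>

lemma finite_subfamily_overlap_two:
  fixes C :: "(real \<times> real) set"
  assumes "finite C"
  shows "\<exists>C'\<subseteq>C. (\<Union>p\<in>C'. {fst p..<snd p}) = (\<Union>p\<in>C. {fst p..<snd p}) \<and>
           (\<forall>x. card {p\<in>C'. x \<in> {fst p..<snd p}} \<le> 2)"
  using assms
proof (induction C rule: finite_psubset_induct)
  case (psubset C)
  show ?case
  proof (cases "\<forall>x. card {p\<in>C. x \<in> {fst p..<snd p}} \<le> 2")
    case False
    then obtain x where x: "card {p\<in>C. x \<in> {fst p..<snd p}} > 2" by (auto simp: not_le)
    define S where "S = {p\<in>C. x \<in> {fst p..<snd p}}"
    have fS: "finite S" using psubset.hyps by (simp add: S_def)
    have "S \<noteq> {}" using x by (metis S_def card.empty not_less_zero)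
    define p where "p = arg_min_on fst S"
    have p: "p \<in> S" "\<And>r. r \<in> S \<Longrightarrow> fst p \<le> fst r"
      using arg_min_if_finite[OF fS \<open>S \<noteq> {}\<close>, of fst] by (auto simp: p_def not_less)
    define q where "q = arg_min_on (\<lambda>r. - snd r) S"
    have q: "q \<in> S" "\<And>r. r \<in> S \<Longrightarrow> snd r \<le> snd q"
      using arg_min_if_finite[OF fS \<open>S \<noteq> {}\<close>, of "\<lambda>r. - snd r"] by (auto simp: q_def not_less)
    have "\<not> S \<subseteq> {p, q}"
      using x card_mono[of "{p, q}" S] card_insert_le_m1[of 2 "{q}" p] by (auto simp: S_def)
    then obtain r where r: "r \<in> S" "r \<noteq> p" "r \<noteq> q" by auto
    have cover: "{fst r..<snd r} \<subseteq> {fst p..<snd p} \<union> {fst q..<snd q}"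
    proof
      fix y assume y: "y \<in> {fst r..<snd r}"
      show "y \<in> {fst p..<snd p} \<union> {fst q..<snd q}"
      proof (cases "y \<le> x")
        case True
        then show ?thesis using y p(1) p(2)[OF r(1)] by (auto simp: S_def)
      next
        case False
        then show ?thesis using y q(1) q(2)[OF r(1)] by (auto simp: S_def)
      qed
    qed
    have "r \<in> C" using r by (simp add: S_def)
    then have "C - {r} \<subset> C" by auto
    from psubset.IH[OF this] obtain C' where C': "C' \<subseteq> C - {r}"
      "(\<Union>p\<in>C'. {fst p..<snd p}) = (\<Union>p\<in>C - {r}. {fst p..<snd p})"
      "\<forall>x. card {p\<in>C'. x \<in> {fst p..<snd p}} \<le> 2" by auto
    have pq: "p \<in> C - {r}" "q \<in> C - {r}" using p q r by (auto simp: S_def)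
    have "(\<Union>p\<in>C - {r}. {fst p..<snd p}) = (\<Union>p\<in>C. {fst p..<snd p})" (is "?A = ?B")
    proof
      have "{fst r..<snd r} \<subseteq> ?A" using cover pq by blast
      then show "?B \<subseteq> ?A" by blast
    qed auto
    with C' show ?thesis by (intro exI[of _ C']) auto
  qed auto
qed

lemma measure_Union_le_overlap:
  fixes N R :: "real measure" and C :: "(real \<times> real) set"
  assumes N: "finite_measure N" "sets N = sets borel"
    and R: "finite_measure R" "sets R = sets borel"
    and "finite C" and U: "U \<in> sets borel" "\<And>p. p \<in> C \<Longrightarrow> {fst p..<snd p} \<subseteq> U"
    and K: "K \<ge> 0" "\<And>p. p \<in> C \<Longrightarrow> measure N {fst p..<snd p} \<le> K * measure R {fst p..<snd p}"
  shows "measure N (\<Union>p\<in>C. {fst p..<snd p}) \<le> 2 * K * measure R U"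
proof -
  interpret N: finite_measure N by fact
  interpret R: finite_measure R by fact
  note [simp] = N(2) R(2) and [measurable_cong] = N(2) R(2)
  obtain C' where C': "C' \<subseteq> C" "(\<Union>p\<in>C'. {fst p..<snd p}) = (\<Union>p\<in>C. {fst p..<snd p})"
    "\<And>x. card {p\<in>C'. x \<in> {fst p..<snd p}} \<le> 2"
    using finite_subfamily_overlap_two[OF \<open>finite C\<close>] by blast
  have fC': "finite C'" using C'(1) \<open>finite C\<close> finite_subset by auto
  have "measure N (\<Union>p\<in>C'. {fst p..<snd p}) \<le> (\<Sum>p\<in>C'. measure N {fst p..<snd p})"
    by (intro N.finite_measure_subadditive_finite fC') auto
  also have "\<dots> \<le> (\<Sum>p\<in>C'. K * measure R {fst p..<snd p})"
    using C'(1) K by (intro sum_mono) auto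
  also have "\<dots> = K * (\<Sum>p\<in>C'. measure R {fst p..<snd p})"
    by (simp add: sum_distrib_left)
  finally have 1: "measure N (\<Union>p\<in>C'. {fst p..<snd p}) \<le> K * (\<Sum>p\<in>C'. measure R {fst p..<snd p})" .
  have "(\<Sum>p\<in>C'. measure R {fst p..<snd p}) =
      (\<integral>x. (\<Sum>p\<in>C'. indicator {fst p..<snd p} x) \<partial>R)"
    by (subst Bochner_Integration.integral_sum)
      (auto simp: R.emeasure_eq_measure sets_eq_imp_space_eq[OF R(2)] intro!: integrable_real_indicator)
  also have "\<dots> \<le> (\<integral>x. 2 * indicator U x \<partial>R)"
  proof (intro integral_mono)
    fix x
    have "(\<Sum>p\<in>C'. indicator {fst p..<snd p} x) = real (card {p\<in>C'. x \<in> {fst p..<snd p}})"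
      using fC' by (simp add: indicator_def sum.If_cases Int_def)
    moreover have "card {p\<in>C'. x \<in> {fst p..<snd p}} = 0" if "x \<notin> U"
    proof -
      have "{p\<in>C'. x \<in> {fst p..<snd p}} = {}" using U(2) C'(1) that by blast
      then show ?thesis by (simp only: card.empty)
    qed
    ultimately show "(\<Sum>p\<in>C'. indicator {fst p..<snd p} x) \<le> 2 * (indicator U x :: real)"
      using C'(3)[of x] by (cases "x \<in> U") auto
  qed (use U in \<open>auto simp: R.emeasure_eq_measure sets_eq_imp_space_eq[OF R(2)]
      intro!: Bochner_Integration.integrable_sum integrable_real_indicator integrable_mult_right\<close>)
  also have "\<dots> = 2 * measure R U"
    using U(1) by (simp add: sets_eq_imp_space_eq[OF R(2)])
  finally have "K * (\<Sum>p\<in>C'. measure R {fst p..<snd p}) \<le> K * (2 * measure R U)"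
    using K(1) by (rule mult_left_mono)
  with 1 show ?thesis using C'(2) by (simp add: ac_simps)
qed

text \<open>
  Lindelof's theorem for the open interiors and continuity from below carry the estimate from finite to
  arbitrary families. The endpoints are dealt with in \<open>endpoints_measure_le\<close>.
\<close>

lemma measure_Union_interiors_le:
  fixes N R :: "real measure" and C :: "(real \<times> real) set"
  assumes N: "finite_measure N" "sets N = sets borel"
    and R: "finite_measure R" "sets R = sets borel"
    and U: "U \<in> sets borel" "\<And>p. p \<in> C \<Longrightarrow> {fst p..<snd p} \<subseteq> U"
    and K: "K \<ge> 0" "\<And>p. p \<in> C \<Longrightarrow> measure N {fst p..<snd p} \<le> K * measure R {fst p..<snd p}"
  shows "measure N (\<Union>p\<in>C. {fst p<..<snd p}) \<le> 2 * K * measure R U"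
proof (cases "C = {}")
  case False
  interpret N: finite_measure N by fact
  interpret R: finite_measure R by fact
  note [simp] = N(2) R(2) and [measurable_cong] = N(2) R(2)
  have op: "open S" if "S \<in> (\<lambda>p. {fst p<..<snd p}) ` C" for S using that by auto
  obtain \<F> where \<F>: "\<F> \<subseteq> (\<lambda>p. {fst p<..<snd p}) ` C" "countable \<F>"
      "\<Union>\<F> = (\<Union>p\<in>C. {fst p<..<snd p})"
    using Lindelof[OF op] by blast
  obtain D where D: "countable D" "D \<subseteq> C" "\<F> = (\<lambda>p. {fst p<..<snd p}) ` D"
    using \<F>(1,2) countable_subset_image[of \<F> "\<lambda>p. {fst p<..<snd p}" C] by auto
  show ?thesis
  proof (cases "D = {}")
    case True
    then have "(\<Union>p\<in>C. {fst p<..<snd p}) = {}" using \<F>(3) D(3) by auto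
    then show ?thesis using K(1) by (simp add: measure_nonneg)
  next
    case False
    define e where "e = from_nat_into D"
    have e: "range e = D" unfolding e_def using D(1) False by (simp add: range_from_nat_into)
    define A where "A n = (\<Union>p\<in>e ` {..n}. {fst p<..<snd p})" for n
    have "(\<lambda>n. measure N (A n)) \<longlonglongrightarrow> measure N (\<Union>n. A n)"
    proof (rule N.finite_Lim_measure_incseq)
      show "range A \<subseteq> sets N" by (auto simp: A_def intro!: sets.finite_UN)
      show "incseq A" by (force simp: A_def incseq_def)
    qed
    moreover have "(\<Union>n. A n) = (\<Union>p\<in>C. {fst p<..<snd p})"
    proof -
      have "(\<Union>n. A n) = (\<Union>p\<in>range e. {fst p<..<snd p})" unfolding A_def by blast
      then show ?thesis using \<F>(3) e D(3) by simp
    qed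
    moreover have "measure N (A n) \<le> 2 * K * measure R U" for n
    proof -
      have "measure N (A n) \<le> measure N (\<Union>p\<in>e ` {..n}. {fst p..<snd p})"
      proof (rule N.finite_measure_mono)
        show "A n \<subseteq> (\<Union>p\<in>e ` {..n}. {fst p..<snd p})" unfolding A_def
          by (intro UN_mono subset_refl) auto
        show "(\<Union>p\<in>e ` {..n}. {fst p..<snd p}) \<in> sets N" by (intro sets.finite_UN) auto
      qed
      also have "\<dots> \<le> 2 * K * measure R U"
      proof (rule measure_Union_le_overlap[OF N R _ U(1) _ K(1)])
        fix p assume "p \<in> e ` {..n}"
        then have "p \<in> C" using e D(2) by auto
        then show "{fst p..<snd p} \<subseteq> U" "measure N {fst p..<snd p} \<le> K * measure R {fst p..<snd p}"
          by (fact U K)+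
      qed simp
      finally show ?thesis .
    qed
    ultimately show ?thesis by (intro LIMSEQ_le_const2[of "\<lambda>n. measure N (A n)"]) auto
  qed
qed (use K in \<open>simp add: measure_nonneg\<close>)

text \<open>
  Intervals with distinct left endpoints, none of which lies in the interior of another interval of the
  family, have disjoint interiors. Each interior contains a rational number, so there are countably many
  such endpoints; right endpoints are treated alike.
\<close>

lemma countable_uncovered_endpoints:
  fixes C :: "(real \<times> real) set"
  assumes "\<And>p. p \<in> C \<Longrightarrow> fst p < snd p"
  shows "countable ((fst ` C \<union> snd ` C) - (\<Union>p\<in>C. {fst p<..<snd p}))"
proof -
  let ?V = "\<Union>p\<in>C. {fst p<..<snd p}"
  have *: "countable (f ` C - ?V)"
    if f: "\<And>p x. p \<in> C \<Longrightarrow> x \<in> {fst p<..<snd p} \<Longrightarrow> {min (f p) x..max (f p) x} \<subseteq> insert (f p) {fst p<..<snd p}" for f :: "real \<times> real \<Rightarrow> real"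
  proof -
    define X where "X q = {f p |p. p \<in> C \<and> real_of_rat q \<in> {fst p<..<snd p}} - ?V" for q
    have "countable (X q)" for q
    proof -
      have le: "x = y \<or> (x < real_of_rat q \<longleftrightarrow> real_of_rat q < y)" if "x \<in> X q" "y \<in> X q" for x y
      proof (rule ccontr)
        assume A: "\<not> ?thesis"
        from that obtain p p' where p: "p \<in> C" "x = f p" "real_of_rat q \<in> {fst p<..<snd p}" "x \<notin> ?V"
          "p' \<in> C" "y = f p'" "real_of_rat q \<in> {fst p'<..<snd p'}" "y \<notin> ?V" by (auto simp: X_def)
        have "{min x (real_of_rat q)..max x (real_of_rat q)} \<subseteq> insert x {fst p<..<snd p}"
          "{min y (real_of_rat q)..max y (real_of_rat q)} \<subseteq> insert y {fst p'<..<snd p'}"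
          using f[of p "real_of_rat q"] f[of p' "real_of_rat q"] p by auto
        moreover have ne: "x \<noteq> real_of_rat q" "y \<noteq> real_of_rat q" using p by auto
        moreover have "y \<notin> {fst p<..<snd p}" "x \<notin> {fst p'<..<snd p'}" using p by auto
        ultimately have "y \<notin> {min x (real_of_rat q)..max x (real_of_rat q)}"
          "x \<notin> {min y (real_of_rat q)..max y (real_of_rat q)}" using A by blast+
        then show False using A ne by (auto simp: min_def max_def split: if_splits)
      qed
      have cs: "countable Y" if "\<And>x y. x \<in> Y \<Longrightarrow> y \<in> Y \<Longrightarrow> x = y" for Y :: "real set"
      proof (cases "Y = {}")
        case False
        then obtain y where "y \<in> Y" by blast
        then have "Y = {y}" using that by blast
        then show ?thesis by simp
      qed simp
      have "countable (X q \<inter> {..<real_of_rat q})" "countable (X q \<inter> {real_of_rat q..})"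
      proof -
        have ne: "x \<noteq> real_of_rat q" if "x \<in> X q" for x using that by (auto simp: X_def)
        show "countable (X q \<inter> {..<real_of_rat q})"
        proof (rule cs)
          fix x y assume "x \<in> X q \<inter> {..<real_of_rat q}" "y \<in> X q \<inter> {..<real_of_rat q}"
          then show "x = y" using le[of x y] by auto
        qed
        show "countable (X q \<inter> {real_of_rat q..})"
        proof (rule cs)
          fix x y assume "x \<in> X q \<inter> {real_of_rat q..}" "y \<in> X q \<inter> {real_of_rat q..}"
          then show "x = y" using le[of x y] ne[of y] by auto
        qed
      qed
      moreover have "X q = (X q \<inter> {..<real_of_rat q}) \<union> (X q \<inter> {real_of_rat q..})" by auto
      ultimately show ?thesis by (metis countable_Un)
    qed
    moreover have "f ` C - ?V \<subseteq> (\<Union>q. X q)"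
    proof
      fix x assume x: "x \<in> f ` C - ?V"
      then obtain p where p: "p \<in> C" "x = f p" by auto
      obtain q where "fst p < real_of_rat q" "real_of_rat q < snd p"
        using of_rat_dense[OF assms[OF p(1)]] by auto
      then have "\<exists>p. x = f p \<and> p \<in> C \<and> real_of_rat q \<in> {fst p<..<snd p}"
        using p by (intro exI[of _ p]) simp
      then have "x \<in> X q" using x unfolding X_def by simp
      then show "x \<in> (\<Union>q. X q)" by blast
    qed
    ultimately show ?thesis by (meson countable_UN countable_subset countableI_type)
  qed
  have "countable (fst ` C - ?V)" by (rule *) auto
  moreover have "countable (snd ` C - ?V)" by (rule *) auto
  ultimately show ?thesis by (simp add: Un_Diff)
qed

text \<open>
  The weak-type estimate behind the differentiation theorem. Endpoints that no interior covers are
  countable in number, so they form a null set if they are not atoms.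
\<close>

lemma endpoints_measure_le:
  fixes N R :: "real measure" and C :: "(real \<times> real) set"
  assumes N: "finite_measure N" "sets N = sets borel"
    and R: "finite_measure R" "sets R = sets borel"
    and U: "U \<in> sets borel" "\<And>p. p \<in> C \<Longrightarrow> {fst p..<snd p} \<subseteq> U"
    and C: "\<And>p. p \<in> C \<Longrightarrow> fst p < snd p"
    and K: "K \<ge> 0" "\<And>p. p \<in> C \<Longrightarrow> measure N {fst p..<snd p} \<le> K * measure R {fst p..<snd p}"
    and B: "B \<subseteq> fst ` C \<union> snd ` C" "\<And>x. x \<in> B \<Longrightarrow> measure N {x} = 0"
  shows "\<exists>S\<in>sets borel. B \<subseteq> S \<and> measure N S \<le> 2 * K * measure R U"
proof -
  interpret N: finite_measure N by fact
  note [simp] = N(2) and [measurable_cong] = N(2)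
  let ?V = "\<Union>p\<in>C. {fst p<..<snd p}"
  have cnt: "countable (B - ?V)"
    by (rule countable_subset[OF _ countable_uncovered_endpoints[of C, OF C]]) (use B in auto)
  have V: "?V \<in> sets borel" by (intro borel_open open_UN) auto
  have "(\<Union>x\<in>B - ?V. {x}) \<in> null_sets N"
    using cnt B(2) by (intro null_sets_UN') (auto simp: null_sets_def N.emeasure_eq_measure)
  then have *: "B - ?V \<in> null_sets N" by simp
  then have "measure N (?V \<union> (B - ?V)) = measure N ?V"
    using V by (intro measure_Un_null_set) auto
  also have "\<dots> \<le> 2 * K * measure R U" by (intro measure_Union_interiors_le N R U K)
  finally have le: "measure N (?V \<union> (B - ?V)) \<le> 2 * K * measure R U" .
  have "?V \<union> (B - ?V) \<in> sets borel" using V null_setsD2[OF *] by (intro sets.Un) auto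
  with le show ?thesis by (intro bexI[of _ "?V \<union> (B - ?V)"]) auto
qed

lemma finite_borel_open_approx:
  fixes R :: "real measure"
  assumes R: "finite_measure R" "sets R = sets borel" and A: "A \<in> sets borel" and "e > 0"
  shows "\<exists>U. open U \<and> A \<subseteq> U \<and> measure R U < measure R A + e"
proof -
  interpret R: finite_measure R by fact
  have "emeasure R A = (INF U \<in> {U. A \<subseteq> U \<and> open U}. emeasure R U)"
    by (rule outer_regular) (use R A R.emeasure_finite in auto)
  moreover have "emeasure R A < ennreal (measure R A + e)"
    using \<open>e > 0\<close> by (simp add: R.emeasure_eq_measure ennreal_less_iff)
  ultimately obtain U where "A \<subseteq> U" "open U" "emeasure R U < ennreal (measure R A + e)"
    by (auto simp: INF_less_iff)
  then show ?thesis by (auto simp: R.emeasure_eq_measure ennreal_less_iff)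
qed

text \<open>
  The weak-type estimate for the family of all null intervals, with constant \<open>0\<close>.
\<close>

lemma AE_measure_interval_pos:
  fixes N :: "real measure"
  assumes N: "finite_measure N" "sets N = sets borel"
  shows "AE x in N. measure N {x} = 0 \<longrightarrow> (\<forall>l u. l < u \<and> (l = x \<or> u = x) \<longrightarrow> measure N {l..<u} > 0)"
proof -
  interpret N: finite_measure N by fact
  define C where "C = {p. fst p < snd p \<and> measure N {fst p..<snd p} = 0}"
  define B where "B = {x. measure N {x} = 0 \<and> x \<in> fst ` C \<union> snd ` C}"
  have "\<exists>S\<in>sets borel. B \<subseteq> S \<and> measure N S \<le> 2 * 0 * measure N UNIV"
    by (rule endpoints_measure_le[OF N N, where C = C]) (auto simp: B_def C_def)
  then obtain S where S: "S \<in> null_sets N" "B \<subseteq> S"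
    using N(2) by (auto simp: null_sets_def N.emeasure_eq_measure measure_le_0_iff)
  from AE_not_in[OF S(1)] show ?thesis
  proof eventually_elim
    case (elim x)
    then have "x \<notin> B" using S by auto
    then show ?case by (force simp: B_def C_def image_iff less_le)
  qed
qed

text \<open>
  For a rational \<open>r\<close>, the measure with density \<open>(f - r)\<^sup>+\<close> vanishes on \<open>{f \<le> r}\<close>, hence is arbitrarily small
  on some open superset of it. By the weak-type estimate, the points of \<open>{f \<le> r}\<close> at which the average of
  \<open>(f - r)\<^sup>+\<close> is at least \<open>1 / (n + 1)\<close> along shrinking intervals form a null set. Elsewhere, a rational \<open>r\<close>
  slightly above \<open>f x\<close> bounds the averages of \<open>f\<close> itself. This avoids approximation by continuous
  functions.
\<close>

lemma AE_average_upper_bound: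
  fixes N :: "real measure" and f :: "real \<Rightarrow> real"
  assumes N: "finite_measure N" "sets N = sets borel" and f: "integrable N f"
  shows "AE x in N. measure N {x} = 0 \<longrightarrow> (\<forall>\<eta>>0. \<exists>\<delta>>0. \<forall>l u. l < u \<and> (l = x \<or> u = x) \<and> u - l < \<delta> \<longrightarrow>
    (LINT t:{l..<u}|N. f t) \<le> (f x + \<eta>) * measure N {l..<u})"
proof -
  interpret N: finite_measure N by fact
  note [simp] = N(2) and [measurable_cong] = N(2)
  have sp[simp]: "space N = UNIV" using sets_eq_imp_space_eq[OF N(2)] by simp
  have [measurable]: "f \<in> borel_measurable borel"
    using borel_measurable_integrable[OF f] by (simp cong: measurable_cong_sets)
  define R where "R r = density N (\<lambda>t. ennreal (max 0 (f t - r)))" for r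
  have int: "integrable N (\<lambda>t. max 0 (f t - r))" for r
    by (intro integrable_max Bochner_Integration.integrable_diff f) auto
  have [simp]: "sets (R r) = sets borel" for r by (simp add: R_def)
  have Rm: "measure (R r) A = (LINT t:A|N. max 0 (f t - r))" if "A \<in> sets borel" for A r
    unfolding R_def by (rule finite_measure_density_real(2)[OF int]) (use that in auto)
  have Rf: "finite_measure (R r)" for r
    unfolding R_def by (rule finite_measure_density_real(1)[OF int]) auto
  define C where "C r n = {p. fst p < snd p \<and> measure N {fst p..<snd p} \<le> real (Suc n) * measure (R r) {fst p..<snd p}}" for r and n :: nat
  define B where "B r n = {x. measure N {x} = 0 \<and> f x \<le> r \<and>
      (\<forall>\<delta>>0. \<exists>p\<in>C r n. (fst p = x \<or> snd p = x) \<and> snd p - fst p < \<delta>)}" for r n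
  have small: "\<exists>S\<in>sets borel. B r n \<subseteq> S \<and> measure N S < e" if "e > 0" for r n e
  proof -
    let ?A = "{t. f t \<le> r}"
    let ?e = "e / (2 * real (Suc n))"
    have e: "?e > 0" using that by simp
    have "measure (R r) ?A = (LINT t:?A|N. 0)"
      by (subst Rm, simp, rule set_lebesgue_integral_cong) (auto simp: max_def)
    then have 0: "measure (R r) ?A = 0" by (simp add: set_lebesgue_integral_def)
    obtain U where U: "open U" "?A \<subseteq> U" "measure (R r) U < ?e"
      using finite_borel_open_approx[OF Rf[of r] _ _ e, of ?A] 0 by auto
    \<comment> \<open>the intervals of the family inside \<open>U\<close> still reach every point of \<open>B r n\<close>\<close>
    define D where "D = {p\<in>C r n. {fst p..snd p} \<subseteq> U}"
    have "\<exists>S\<in>sets borel. B r n \<subseteq> S \<and> measure N S \<le> 2 * real (Suc n) * measure (R r) U"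
    proof (rule endpoints_measure_le[OF N Rf, where C = D])
      show "B r n \<subseteq> fst ` D \<union> snd ` D"
      proof
        fix x assume x: "x \<in> B r n"
        then have "x \<in> U" using U by (auto simp: B_def)
        then obtain \<delta> where d: "\<delta> > 0" "cball x \<delta> \<subseteq> U" using U(1) open_contains_cball by blast
        with x obtain p where p: "p \<in> C r n" "fst p = x \<or> snd p = x" "snd p - fst p < \<delta>"
          by (auto simp: B_def)
        have "{fst p..snd p} \<subseteq> cball x \<delta>" using p by (auto simp: dist_real_def)
        then have "p \<in> D" using p d by (auto simp: D_def)
        then show "x \<in> fst ` D \<union> snd ` D" using p by auto
      qed
    qed (use U in \<open>auto simp: D_def C_def B_def\<close>)
    moreover have "2 * real (Suc n) * measure (R r) U < e"
      using U(3) by (simp add: field_simps)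
    ultimately show ?thesis by (auto intro: le_less_trans)
  qed
  have "\<exists>S. S \<in> null_sets N \<and> B r n \<subseteq> S" for r n
  proof -
    have "\<forall>m. \<exists>S\<in>sets borel. B r n \<subseteq> S \<and> measure N S < 1 / real (Suc m)"
      using small by auto
    then obtain S where S: "\<And>m. S m \<in> sets borel" "\<And>m. B r n \<subseteq> S m" "\<And>m. measure N (S m) < 1 / real (Suc m)"
      by metis
    have "measure N (\<Inter>m. S m) < 1 / real (Suc m)" for m
      using S N.finite_measure_mono[of "\<Inter>m. S m" "S m"] by (force intro: le_less_trans)
    then have "measure N (\<Inter>m. S m) = 0"
      using nat_approx_posE[of "measure N (\<Inter>m. S m)"] measure_nonneg[of N "\<Inter>m. S m"]
      by (metis less_asym less_le)
    then have "(\<Inter>m. S m) \<in> null_sets N" using S by (auto simp: null_sets_def N.emeasure_eq_measure)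
    then show ?thesis using S by auto
  qed
  then obtain S where S: "\<And>r n. S r n \<in> null_sets N" "\<And>r n. B r n \<subseteq> S r n" by metis
  have "(\<Union>q. \<Union>n. S (real_of_rat q) n) \<in> null_sets N" using S by (intro null_sets_UN) auto
  from AE_not_in[OF this] show ?thesis
  proof (eventually_elim, intro impI allI)
    fix x \<eta> :: real
    assume x: "x \<notin> (\<Union>q. \<Union>n. S (real_of_rat q) n)" and x0: "measure N {x} = 0" and "\<eta> > 0"
    obtain q where q: "f x < real_of_rat q" "real_of_rat q < f x + \<eta> / 2"
      using of_rat_dense[of "f x" "f x + \<eta> / 2"] \<open>\<eta> > 0\<close> by auto
    obtain n where n: "1 / real (Suc n) < \<eta> / 2" using nat_approx_posE[of "\<eta> / 2"] \<open>\<eta> > 0\<close> by auto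
    have "x \<notin> S (real_of_rat q) n" using x by simp
    then have "x \<notin> B (real_of_rat q) n" by (rule contra_subsetD[OF S(2)])
    then have "\<not> (\<forall>\<delta>>0. \<exists>p\<in>C (real_of_rat q) n. (fst p = x \<or> snd p = x) \<and> snd p - fst p < \<delta>)"
      using x0 q(1) unfolding B_def by simp
    then obtain \<delta> where d: "\<delta> > 0" "\<And>p. p \<in> C (real_of_rat q) n \<Longrightarrow> fst p = x \<or> snd p = x \<Longrightarrow> \<not> snd p - fst p < \<delta>"
      by blast
    show "\<exists>\<delta>>0. \<forall>l u. l < u \<and> (l = x \<or> u = x) \<and> u - l < \<delta> \<longrightarrow>
      (LINT t:{l..<u}|N. f t) \<le> (f x + \<eta>) * measure N {l..<u}"
    proof (intro exI[of _ \<delta>] conjI d(1) allI impI)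
      fix l u assume lu: "l < u \<and> (l = x \<or> u = x) \<and> u - l < \<delta>"
      let ?r = "real_of_rat q"
      have "(l, u) \<notin> C ?r n" using d(2)[of "(l, u)"] lu by auto
      then have "real (Suc n) * measure (R ?r) {l..<u} < measure N {l..<u}"
        using lu by (auto simp: C_def)
      then have R: "measure (R ?r) {l..<u} \<le> 1 / real (Suc n) * measure N {l..<u}"
        by (simp add: field_simps)
      have si: "set_integrable N {l..<u} h" if "integrable N h" for h :: "real \<Rightarrow> real"
        using that integrable_mult_indicator[of "{l..<u}" N h] by (auto simp: set_integrable_def)
      have "(LINT t:{l..<u}|N. f t) \<le> (LINT t:{l..<u}|N. ?r + max 0 (f t - ?r))"
        by (rule set_integral_mono[OF si[OF f] si[OF Bochner_Integration.integrable_add[OF _ int]]]) auto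
      also have "\<dots> = ?r * measure N {l..<u} + measure (R ?r) {l..<u}"
        using si[of "\<lambda>_. ?r"] si[OF int[of ?r]]
        by (subst set_integral_add(2)) (simp_all add: Rm, simp add: set_lebesgue_integral_def)
      also have "\<dots> \<le> (f x + \<eta> / 2) * measure N {l..<u} + \<eta> / 2 * measure N {l..<u}"
        using q n by (intro add_mono order_trans[OF R] mult_right_mono) auto
      also have "\<dots> = (f x + \<eta>) * measure N {l..<u}" by (simp add: field_simps)
      finally show "(LINT t:{l..<u}|N. f t) \<le> (f x + \<eta>) * measure N {l..<u}" .
    qed
  qed
qed

lemma AE_average_tendsto:
  fixes N :: "real measure" and f :: "real \<Rightarrow> real"
  assumes N: "finite_measure N" "sets N = sets borel" and f: "integrable N f"
  shows "AE x in N. measure N {x} = 0 \<longrightarrow> (\<forall>\<eta>>0. \<exists>\<delta>>0. \<forall>l u. l < u \<and> (l = x \<or> u = x) \<and> u - l < \<delta> \<longrightarrow>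
    \<bar>(LINT t:{l..<u}|N. f t) - f x * measure N {l..<u}\<bar> \<le> \<eta> * measure N {l..<u})"
proof -
  have g: "integrable N (\<lambda>t. - f t)" using f by simp
  from AE_average_upper_bound[OF N f] AE_average_upper_bound[OF N g] show ?thesis
  proof (eventually_elim, intro impI allI)
    fix x \<eta> :: real
    assume A: "measure N {x} = 0 \<longrightarrow> (\<forall>\<eta>>0. \<exists>\<delta>>0. \<forall>l u. l < u \<and> (l = x \<or> u = x) \<and> u - l < \<delta> \<longrightarrow>
        (LINT t:{l..<u}|N. f t) \<le> (f x + \<eta>) * measure N {l..<u})"
     and B: "measure N {x} = 0 \<longrightarrow> (\<forall>\<eta>>0. \<exists>\<delta>>0. \<forall>l u. l < u \<and> (l = x \<or> u = x) \<and> u - l < \<delta> \<longrightarrow>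
        (LINT t:{l..<u}|N. - f t) \<le> (- f x + \<eta>) * measure N {l..<u})"
     and "measure N {x} = 0" "\<eta> > 0"
    then obtain d1 d2 where d: "d1 > 0" "d2 > 0"
      "\<And>l u. l < u \<and> (l = x \<or> u = x) \<and> u - l < d1 \<Longrightarrow> (LINT t:{l..<u}|N. f t) \<le> (f x + \<eta>) * measure N {l..<u}"
      "\<And>l u. l < u \<and> (l = x \<or> u = x) \<and> u - l < d2 \<Longrightarrow> (LINT t:{l..<u}|N. - f t) \<le> (- f x + \<eta>) * measure N {l..<u}"
      by metis
    show "\<exists>\<delta>>0. \<forall>l u. l < u \<and> (l = x \<or> u = x) \<and> u - l < \<delta> \<longrightarrow>
      \<bar>(LINT t:{l..<u}|N. f t) - f x * measure N {l..<u}\<bar> \<le> \<eta> * measure N {l..<u}"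
    proof (intro exI[of _ "min d1 d2"] conjI allI impI)
      fix l u assume "l < u \<and> (l = x \<or> u = x) \<and> u - l < min d1 d2"
      with d(3)[of l u] d(4)[of l u]
      show "\<bar>(LINT t:{l..<u}|N. f t) - f x * measure N {l..<u}\<bar> \<le> \<eta> * measure N {l..<u}"
        by (auto simp: algebra_simps set_lebesgue_integral_def abs_le_iff)
    qed (use d in auto)
  qed
qed

section \<open>The exponential of an indefinite integral\<close>

text \<open>
  Both bounds follow from the tangent inequality \<open>exp v (u - v) \<le> exp u - exp v\<close> by exchanging the two
  points.
\<close>

lemma exp_mean_value_bounds:
  fixes p q L :: real
  assumes "\<bar>p\<bar> \<le> L" "\<bar>q\<bar> \<le> L"
  shows "\<bar>exp p - exp q\<bar> \<le> exp L * \<bar>p - q\<bar>"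
    and "\<bar>exp p - exp q - exp q * (p - q)\<bar> \<le> exp L * (p - q)\<^sup>2"
proof -
  have tan: "exp v * (u - v) \<le> exp u - exp v" for u v :: real
    using exp_ge_add_one_self[of "u - v"] mult_left_mono[of "1 + (u - v)" "exp (u - v)" "exp v"]
    by (simp add: exp_diff algebra_simps)
  have le: "exp u - exp v \<le> exp L * \<bar>u - v\<bar>" if "\<bar>u\<bar> \<le> L" for u v :: real
  proof -
    have "exp u - exp v \<le> exp u * (u - v)" using tan[of u v] by (simp add: algebra_simps)
    also have "\<dots> \<le> exp u * \<bar>u - v\<bar>" by (intro mult_left_mono) auto
    also have "\<dots> \<le> exp L * \<bar>u - v\<bar>" using that by (intro mult_right_mono) auto
    finally show ?thesis .
  qed
  show 1: "\<bar>exp p - exp q\<bar> \<le> exp L * \<bar>p - q\<bar>"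
    using le[of p q] le[of q p] assms by (auto simp: abs_minus_commute)
  have "exp p - exp q - exp q * (p - q) \<le> (exp p - exp q) * (p - q)"
    using tan[of p q] by (simp add: algebra_simps)
  also have "\<dots> \<le> \<bar>exp p - exp q\<bar> * \<bar>p - q\<bar>" by (metis abs_ge_self abs_mult)
  also have "\<dots> \<le> exp L * \<bar>p - q\<bar> * \<bar>p - q\<bar>" by (intro mult_right_mono 1) auto
  finally show "\<bar>exp p - exp q - exp q * (p - q)\<bar> \<le> exp L * (p - q)\<^sup>2"
    using tan[of q p] by (simp add: power2_eq_square abs_mult_self_eq mult.assoc)
qed

lemma punctured_nbhd_measure_small:
  fixes L :: "real measure"
  assumes L: "finite_measure L" "sets L = sets borel" and "e > 0"
  shows "\<exists>d>0. measure L ({x - d<..<x + d} - {x}) < e"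
proof -
  interpret L: finite_measure L by fact
  define D where "D n = {x - 1 / real (Suc n)<..<x + 1 / real (Suc n)} - {x}" for n
  have "(\<lambda>n. measure L (D n)) \<longlonglongrightarrow> measure L (\<Inter>n. D n)"
  proof (rule L.finite_Lim_measure_decseq)
    have "open (D n)" for n unfolding D_def by (intro open_Diff) auto
    then show "range D \<subseteq> sets L" using L(2) borel_open by blast
    show "decseq D"
    proof (rule decseq_SucI)
      fix n
      have "1 / real (Suc (Suc n)) \<le> 1 / real (Suc n)" by (simp add: field_simps)
      then show "D (Suc n) \<subseteq> D n" by (auto simp: D_def)
    qed
  qed
  moreover have "(\<Inter>n. D n) = {}"
  proof (rule ccontr)
    assume "(\<Inter>n. D n) \<noteq> {}"
    then obtain y where y: "\<And>n. y \<in> D n" by auto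
    from y[of 0] have "\<bar>y - x\<bar> > 0" by (simp add: D_def)
    then obtain n where "1 / real (Suc n) < \<bar>y - x\<bar>" using nat_approx_posE by blast
    with y[of n] show False by (auto simp: D_def)
  qed
  ultimately have "(\<lambda>n. measure L (D n)) \<longlonglongrightarrow> 0" by simp
  then have "eventually (\<lambda>n. measure L (D n) < e) sequentially" using \<open>e > 0\<close> by (rule order_tendstoD)
  then obtain n where "measure L (D n) < e" by (auto simp: eventually_sequentially)
  then show ?thesis by (intro exI[of _ "1 / real (Suc n)"]) (auto simp: D_def)
qed

lemma countable_finite_subset_measure_small:
  fixes L :: "real measure"
  assumes L: "finite_measure L" "sets L = sets borel" and "countable A" "e > 0"
  shows "\<exists>F. finite F \<and> measure L (A - F) < e"
proof (cases "A = {}")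
  case False
  interpret L: finite_measure L by fact
  define en where "en = from_nat_into A"
  have en: "range en = A" unfolding en_def using assms(3) False by (simp add: range_from_nat_into)
  define D where "D n = A - en ` {..n}" for n
  have A: "X \<in> sets borel" if "X \<subseteq> A" for X
    by (rule sets.countable[OF _ countable_subset[OF that \<open>countable A\<close>]]) auto
  have "(\<lambda>n. measure L (D n)) \<longlonglongrightarrow> measure L (\<Inter>n. D n)"
    by (rule L.finite_Lim_measure_decseq) (auto simp: L(2) D_def decseq_def intro!: A)
  moreover have "(\<Inter>n. D n) = {}" using en by (auto simp: D_def)
  ultimately have "(\<lambda>n. measure L (D n)) \<longlonglongrightarrow> 0" by simp
  then have "eventually (\<lambda>n. measure L (D n) < e) sequentially" using \<open>e > 0\<close> by (rule order_tendstoD)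
  then obtain n where "measure L (D n) < e" by (auto simp: eventually_sequentially)
  then show ?thesis by (intro exI[of _ "en ` {..n}"]) (auto simp: D_def)
qed (use \<open>e > 0\<close> in auto)

lemma borel_measurable_indefinite_integral:
  fixes N :: "real measure" and k :: "real \<Rightarrow> real"
  assumes N: "sets N = sets borel" and k: "integrable N k"
  shows "(\<lambda>t. LINT s:{a..<t}|N. k s) \<in> borel_measurable borel"
proof -
  have mono: "mono (\<lambda>t. LINT s:{a..<t}|N. h s)" if h: "integrable N h" "\<And>s. 0 \<le> h s" for h :: "real \<Rightarrow> real"
  proof (rule monoI)
    fix x y :: real assume xy: "x \<le> y"
    show "(LINT s:{a..<x}|N. h s) \<le> (LINT s:{a..<y}|N. h s)"
      unfolding set_lebesgue_integral_def
    proof (rule integral_mono)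
      show "integrable N (\<lambda>s. indicat_real {a..<x} s *\<^sub>R h s)" "integrable N (\<lambda>s. indicat_real {a..<y} s *\<^sub>R h s)"
        using h(1) N by (intro integrable_mult_indicator; simp)+
      show "indicat_real {a..<x} s *\<^sub>R h s \<le> indicat_real {a..<y} s *\<^sub>R h s" for s
        using h(2)[of s] xy by (auto simp: indicator_def)
    qed
  qed
  have "(\<lambda>t. LINT s:{a..<t}|N. k s) = (\<lambda>t. (LINT s:{a..<t}|N. max 0 (k s)) - (LINT s:{a..<t}|N. max 0 (- k s)))"
  proof
    fix t
    have "(LINT s:{a..<t}|N. max 0 (k s)) - (LINT s:{a..<t}|N. max 0 (- k s)) = (LINT s:{a..<t}|N. max 0 (k s) - max 0 (- k s))"
      using k N by (intro set_integral_diff(2)[symmetric] integrable_imp_set_integrable) auto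
    also have "(\<lambda>s. max 0 (k s) - max 0 (- k s)) = k" by (auto simp: max_def)
    finally show "(LINT s:{a..<t}|N. k s) = (LINT s:{a..<t}|N. max 0 (k s)) - (LINT s:{a..<t}|N. max 0 (- k s))" by simp
  qed
  moreover have "(\<lambda>t. LINT s:{a..<t}|N. max 0 (k s)) \<in> borel_measurable borel"
    "(\<lambda>t. LINT s:{a..<t}|N. max 0 (- k s)) \<in> borel_measurable borel"
    using k by (auto intro!: borel_measurable_mono mono)
  ultimately show ?thesis by simp
qed

lemma exp_integral_le:
  fixes N :: "real measure" and k :: "real \<Rightarrow> real"
  assumes N: "sets N = sets borel" and k: "integrable N k"
  shows "exp (LINT s:{a..<t}|N. k s) \<le> exp (LINT s|N. \<bar>k s\<bar>)"
proof -
  have "(LINT s:{a..<t}|N. k s) \<le> (LINT s|N. \<bar>k s\<bar>)"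
    unfolding set_lebesgue_integral_def
  proof (rule integral_mono)
    show "integrable N (\<lambda>s. indicat_real {a..<t} s *\<^sub>R k s)"
      using k N by (intro integrable_mult_indicator) auto
  qed (use k in \<open>auto simp: indicator_def\<close>)
  then show ?thesis by simp
qed

lemma integrable_times_exponential:
  fixes N :: "real measure" and k h :: "real \<Rightarrow> real"
  assumes N: "sets N = sets borel" and k: "integrable N k" and h: "integrable N h"
  shows "integrable N (\<lambda>s. h s * exp (LINT r:{a..<s}|N. k r))"
proof (rule Bochner_Integration.integrable_bound)
  show "integrable N (\<lambda>s. h s * exp (LINT r|N. \<bar>k r\<bar>))" using h by simp
  have [measurable_cong]: "sets N = sets borel" by fact
  have [measurable]: "(\<lambda>t. LINT s:{a..<t}|N. k s) \<in> borel_measurable borel"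
    by (rule borel_measurable_indefinite_integral[OF N k])
  have [measurable]: "h \<in> borel_measurable borel" using borel_measurable_integrable[OF h] by (simp cong: measurable_cong_sets add: N)
  show "(\<lambda>s. h s * exp (LINT r:{a..<s}|N. k r)) \<in> borel_measurable N" by measurable
  show "AE s in N. norm (h s * exp (LINT r:{a..<s}|N. k r)) \<le> norm (h s * exp (LINT r|N. \<bar>k r\<bar>))"
    using exp_integral_le[OF N k] by (intro AE_I2) (auto simp: abs_mult intro!: mult_left_mono)
qed

text \<open>
  The defect \<open>m t = E t - 1 - \<integral>\<^bsub>[a, t)\<^esub> h E\<close> is bounded by an arbitrarily small additive set function.
  Let \<open>L\<close> be the measure with density \<open>|k| + |h|\<close> and let \<open>F\<close> be a finite set such
  that \<open>A - F\<close> has small mass. A point has a neighbourhood that contains no further element of \<open>F\<close> and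
  whose part outside the point has small mass; there the increments of \<open>m\<close> over the intervals to the left and to the right
  of the point are controlled by the second-order estimate, while the point itself contributes nothing by the
  hypothesis on jumps. Bisection (\<open>Bolzano\<close>) adds up the local bounds.
\<close>

theorem exponential_integral_equation:
  fixes N :: "real measure" and k h :: "real \<Rightarrow> real" and a T :: real
  defines "E \<equiv> (\<lambda>t. exp (LINT s:{a..<t}|N. k s))"
  assumes N: "finite_measure N" "sets N = sets borel"
    and k: "integrable N k" and h: "integrable N h"
    and A: "countable A" "\<And>x. x \<notin> A \<Longrightarrow> k x = h x"
    and jump: "\<And>x. exp (k x * measure N {x}) - 1 = h x * measure N {x}"
    and "a \<le> T"
  shows "E T = 1 + (LINT s:{a..<T}|N. h s * E s)"
proof -
  interpret N: finite_measure N by fact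
  have [measurable_cong]: "sets N = sets borel" by fact
  note [simp] = N(2)
  have sp[simp]: "space N = UNIV" using sets_eq_imp_space_eq[OF N(2)] by simp
  have [measurable]: "k \<in> borel_measurable borel" "h \<in> borel_measurable borel"
    using borel_measurable_integrable[OF k] borel_measurable_integrable[OF h] by (simp_all cong: measurable_cong_sets)
  have A_sets: "X \<in> sets borel" if "X \<subseteq> A" for X
    by (rule sets.countable[OF _ countable_subset[OF that \<open>countable A\<close>]]) auto
  have [measurable]: "A \<in> sets borel" by (rule A_sets) simp
  define \<phi> where "\<phi> t = (LINT s:{a..<t}|N. k s)" for t
  have E: "E t = exp (\<phi> t)" for t by (simp add: E_def \<phi>_def)
  define q where "q s = \<bar>k s\<bar> + \<bar>h s\<bar>" for s
  have q: "integrable N q" unfolding q_def using k h by simp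
  define L where "L = density N (\<lambda>s. ennreal (q s))"
  have [simp]: "sets L = sets borel" by (simp add: L_def)
  have Lf: "finite_measure L" unfolding L_def by (rule finite_measure_density_real[OF q]) (simp add: q_def)
  interpret L: finite_measure L by fact
  have Lm: "measure L S = (LINT s:S|N. q s)" if "S \<in> sets borel" for S
    unfolding L_def by (rule finite_measure_density_real[OF q]) (use that in \<open>auto simp: q_def\<close>)
  define \<Lambda> where "\<Lambda> = measure L UNIV"
  define C where "C = exp \<Lambda>"
  have C: "C \<ge> 0" by (simp add: C_def)
  have \<Lambda>: "measure L S \<le> \<Lambda>" for S
    unfolding \<Lambda>_def using L.bounded_measure[of S] sets_eq_imp_space_eq[of L borel] by simp
  have hE: "integrable N (\<lambda>s. h s * E s)"
    unfolding E_def by (rule integrable_times_exponential) (use N k h in auto)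
  have kE: "integrable N (\<lambda>s. k s * E s)"
    unfolding E_def by (rule integrable_times_exponential) (use N k h in auto)
  note si = integrable_imp_set_integrable[OF k] integrable_imp_set_integrable[OF hE]
    integrable_imp_set_integrable[OF kE] integrable_imp_set_integrable[OF q]
  have kL: "\<bar>LINT s:S|N. k s\<bar> \<le> measure L S" if S: "S \<in> sets borel" for S
  proof -
    have "\<bar>LINT s:S|N. k s\<bar> \<le> (LINT s:S|N. q s)"
      using set_integral_norm_bound[OF si(1)[of S]] S
      by (rule_tac order_trans[OF _ set_integral_mono[of N S "\<lambda>s. norm (k s)" q]])
        (auto simp: q_def[abs_def] intro!: integrable_imp_set_integrable k h)
    then show ?thesis by (simp add: Lm S)
  qed
  have \<phi>_le: "\<bar>\<phi> t\<bar> \<le> \<Lambda>" for t using kL[of "{a..<t}"] \<Lambda>[of "{a..<t}"] by (simp add: \<phi>_def)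
  have \<phi>_add: "\<phi> t = \<phi> s + (LINT u:{s..<t}|N. k u)" if "a \<le> s" "s \<le> t" for s t
  proof -
    have "{a..<t} = {a..<s} \<union> {s..<t}" using that by auto
    then show ?thesis unfolding \<phi>_def by (simp only:) (rule set_integral_Un, auto intro!: si)
  qed
  \<comment> \<open>The value \<open>p\<close> is that of \<open>\<phi>\<close> at the left end of \<open>J\<close>, with the jump there included if \<open>J\<close> is open.\<close>
  have est: "\<bar>exp (p + (LINT s:J|N. k s)) - exp p - (LINT s:J|N. h s * E s)\<bar>
      \<le> 2 * C * (measure L J)\<^sup>2 + C * measure L (J \<inter> A)"
    if [measurable]: "J \<in> sets borel" and p: "\<bar>p\<bar> \<le> \<Lambda>" "\<bar>p + (LINT s:J|N. k s)\<bar> \<le> \<Lambda>"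
      and J: "\<And>u. u \<in> J \<Longrightarrow> \<bar>\<phi> u - p\<bar> \<le> measure L J" for J p
  proof -
    let ?k = "LINT s:J|N. k s"
    have 1: "\<bar>exp (p + ?k) - exp p - exp p * ?k\<bar> \<le> C * (measure L J)\<^sup>2"
    proof -
      have "\<bar>exp (p + ?k) - exp p - exp p * ?k\<bar> \<le> C * ?k\<^sup>2"
        using exp_mean_value_bounds(2)[OF p(2,1)] by (simp add: C_def)
      also have "?k\<^sup>2 \<le> (measure L J)\<^sup>2" using kL[of J] by (simp add: abs_le_square_iff[symmetric])
      finally show ?thesis using C by (simp add: mult_left_mono)
    qed
    have i1: "set_integrable N J (\<lambda>s. (h s - k s) * E s)"
      using set_integral_diff(1)[OF si(2,3)[of J]] by (simp add: algebra_simps)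
    have i2: "set_integrable N J (\<lambda>s. k s * (E s - exp p))"
      using set_integral_diff(1)[OF si(3)[of J] set_integrable_mult_left[of "exp p" N J k]] si(1)[of J]
      by (simp add: algebra_simps)
    have "(LINT s:J|N. h s * E s) - exp p * ?k = (LINT s:J|N. (h s - k s) * E s) + (LINT s:J|N. k s * (E s - exp p))"
    proof -
      have "(LINT s:J|N. (h s - k s) * E s) + (LINT s:J|N. k s * (E s - exp p))
        = (LINT s:J|N. (h s - k s) * E s + k s * (E s - exp p))"
        using i1 i2 by (simp add: set_integral_add(2))
      also have "\<dots> = (LINT s:J|N. h s * E s - exp p * k s)" by (simp add: algebra_simps)
      also have "\<dots> = (LINT s:J|N. h s * E s) - exp p * ?k"
        using si(1,2)[of J] by (subst set_integral_diff(2)) auto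
      finally show ?thesis by simp
    qed
    moreover have "\<bar>LINT s:J|N. (h s - k s) * E s\<bar> \<le> C * measure L (J \<inter> A)"
    proof -
      have "\<bar>LINT s:J|N. (h s - k s) * E s\<bar> \<le> (LINT s:J|N. norm ((h s - k s) * E s))"
        using set_integral_norm_bound[OF i1] by simp
      also have "\<dots> \<le> (LINT s:J|N. C * (indicator A s * q s))"
      proof (rule set_integral_mono)
        show "set_integrable N J (\<lambda>s. norm ((h s - k s) * E s))" using i1 by (rule set_integrable_norm)
        show "set_integrable N J (\<lambda>s. C * (indicator A s * q s))"
          using integrable_real_mult_indicator[OF _ q, of A]
          by (intro integrable_imp_set_integrable integrable_mult_right) (simp_all add: mult.commute)
        show "norm ((h s - k s) * E s) \<le> C * (indicator A s * q s)" for s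
        proof -
          have "E s \<le> C" "E s \<ge> 0" using \<phi>_le[of s] by (auto simp: E C_def)
          moreover have "\<bar>h s - k s\<bar> \<le> indicator A s * q s"
            using A(2)[of s] by (auto simp: indicator_def q_def)
          ultimately have "\<bar>h s - k s\<bar> * E s \<le> (indicator A s * q s) * C"
            by (intro mult_mono) (auto simp: q_def)
          then show ?thesis using \<open>E s \<ge> 0\<close> by (simp add: abs_mult ac_simps)
        qed
      qed
      also have "\<dots> = C * measure L (J \<inter> A)"
        by (subst Lm) (auto simp: set_lebesgue_integral_def indicator_inter_arith mult.assoc
            simp flip: Bochner_Integration.integral_mult_right_zero intro!: Bochner_Integration.integral_cong)
      finally show ?thesis .
    qed
    moreover have "\<bar>LINT s:J|N. k s * (E s - exp p)\<bar> \<le> C * (measure L J)\<^sup>2"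
    proof -
      have "\<bar>LINT s:J|N. k s * (E s - exp p)\<bar> \<le> (LINT s:J|N. norm (k s * (E s - exp p)))"
        using set_integral_norm_bound[OF i2] by simp
      also have "\<dots> \<le> (LINT s:J|N. (C * measure L J) * q s)"
      proof (rule set_integral_mono)
        show "set_integrable N J (\<lambda>s. norm (k s * (E s - exp p)))" using i2 by (rule set_integrable_norm)
        show "set_integrable N J (\<lambda>s. (C * measure L J) * q s)" using si(4)[of J] by simp
        show "norm (k s * (E s - exp p)) \<le> (C * measure L J) * q s" if "s \<in> J" for s
        proof -
          have "\<bar>E s - exp p\<bar> \<le> C * \<bar>\<phi> s - p\<bar>"
            using exp_mean_value_bounds(1)[OF \<phi>_le p(1)] by (simp add: E C_def)
          also have "\<dots> \<le> C * measure L J" using C J[OF that] by (intro mult_left_mono)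
          finally have "\<bar>k s\<bar> * \<bar>E s - exp p\<bar> \<le> q s * (C * measure L J)"
            by (intro mult_mono) (auto simp: q_def)
          then show ?thesis by (simp add: abs_mult ac_simps)
        qed
      qed
      also have "\<dots> = C * (measure L J)\<^sup>2"
        using Lm[of J] by (simp add: power2_eq_square)
      finally show ?thesis .
    qed
    ultimately show ?thesis using 1 by (simp add: abs_le_iff)
  qed
  define m where "m t = E t - 1 - (LINT s:{a..<t}|N. h s * E s)" for t
  have m_add: "m t - m s = E t - E s - (LINT u:{s..<t}|N. h u * E u)" if "a \<le> s" "s \<le> t" for s t
  proof -
    have "{a..<t} = {a..<s} \<union> {s..<t}" using that by auto
    then have "(LINT u:{a..<t}|N. h u * E u) = (LINT u:{a..<s}|N. h u * E u) + (LINT u:{s..<t}|N. h u * E u)"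
      by (simp only:) (rule set_integral_Un, auto intro!: si)
    then show ?thesis by (simp add: m_def)
  qed
  have bound: "\<bar>m T - m a\<bar> \<le> e * (2 * C * \<Lambda> + C)" if "e > 0" for e
  proof -
    obtain F where F: "finite F" "measure L (A - F) < e"
      using countable_finite_subset_measure_small[OF Lf _ A(1) \<open>e > 0\<close>] by auto
    have AF: "A - F \<in> sets borel" by (rule A_sets) auto
    \<comment> \<open>The additive majorant of the increments of \<open>m\<close>; it tends to \<open>0\<close> with \<open>e\<close>.\<close>
    define b where "b S = 2 * C * e * measure L S + C * measure L (S \<inter> (A - F))" for S
    have b_add: "b (S \<union> S') = b S + b S'" if "S \<in> sets borel" "S' \<in> sets borel" "S \<inter> S' = {}" for S S'
    proof -
      have "(S \<union> S') \<inter> (A - F) = (S \<inter> (A - F)) \<union> (S' \<inter> (A - F))" by auto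
      moreover have "measure L ((S \<inter> (A - F)) \<union> (S' \<inter> (A - F))) = measure L (S \<inter> (A - F)) + measure L (S' \<inter> (A - F))"
        using that AF by (intro L.finite_measure_Union) auto
      moreover have "measure L (S \<union> S') = measure L S + measure L S'"
        using that by (intro L.finite_measure_Union) auto
      ultimately show ?thesis by (simp add: b_def algebra_simps)
    qed
    have b_nonneg: "b S \<ge> 0" for S using C \<open>e > 0\<close> by (simp add: b_def)
    define P where "P s t \<longleftrightarrow> (a \<le> s \<longrightarrow> \<bar>m t - m s\<bar> \<le> b {s..<t})" for s t
    have "P a T"
    proof (rule Bolzano[OF \<open>a \<le> T\<close>])
      fix s t u assume A: "P s t" "P t u" "s \<le> t" "t \<le> u"
      show "P s u"
        unfolding P_def
      proof
        assume "a \<le> s"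
        have "{s..<u} = {s..<t} \<union> {t..<u}" using A by auto
        then have "b {s..<u} = b {s..<t} + b {t..<u}" by (simp only:) (rule b_add, auto)
        then show "\<bar>m u - m s\<bar> \<le> b {s..<u}" using A \<open>a \<le> s\<close> by (auto simp: P_def)
      qed
    next
      fix x assume ax: "a \<le> x"
      obtain d1 where d1: "d1 > 0" "measure L ({x - d1<..<x + d1} - {x}) < e"
        using punctured_nbhd_measure_small[OF Lf _ \<open>e > 0\<close>] by auto
      obtain d2 where d2: "d2 > 0" "\<And>y. y \<in> F \<Longrightarrow> y \<noteq> x \<Longrightarrow> d2 \<le> dist x y"
        using finite_set_avoid[OF F(1)] by metis
      define d where "d = min d1 d2"
      have sm: "2 * C * (measure L J)\<^sup>2 + C * measure L (J \<inter> A) \<le> b J"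
        if J: "J \<in> sets borel" "J \<subseteq> {x - d<..<x + d} - {x}" for J
      proof -
        have "J \<subseteq> {x - d1<..<x + d1} - {x}" using J(2) by (rule order_trans) (auto simp: d_def)
        then have "measure L J \<le> e"
          using d1(2) L.finite_measure_mono[of J "{x - d1<..<x + d1} - {x}"] by auto
        then have "measure L J * measure L J \<le> e * measure L J" by (intro mult_right_mono) auto
        moreover have "J \<inter> A = J \<inter> (A - F)"
        proof -
          have "y \<notin> F" if "y \<in> J" for y
          proof
            assume "y \<in> F"
            moreover have "y \<in> {x - d<..<x + d} - {x}" using J(2) that by blast
            then have "y \<noteq> x" "dist x y < d" by (auto simp: dist_real_def)
            ultimately show False using d2(2)[of y] by (auto simp: d_def)
          qed
          then show ?thesis by auto
        qed
        ultimately show ?thesis using C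
          by (auto simp: b_def power2_eq_square mult.assoc intro!: mult_left_mono)
      qed
      show "\<exists>d>0. \<forall>s t. s \<le> x \<and> x \<le> t \<and> t - s < d \<longrightarrow> P s t"
        unfolding P_def
      proof (intro exI[of _ d] conjI allI impI)
        show "d > 0" using d1 d2 by (simp add: d_def)
        fix s t assume st: "s \<le> x \<and> x \<le> t \<and> t - s < d" and "a \<le> s"
        have left: "\<bar>m x - m s\<bar> \<le> b {s..<x}"
        proof -
          have "\<bar>\<phi> u - \<phi> s\<bar> \<le> measure L {s..<x}" if "u \<in> {s..<x}" for u
            using \<phi>_add[of s u] kL[of "{s..<u}"] L.finite_measure_mono[of "{s..<u}" "{s..<x}"] that \<open>a \<le> s\<close> by auto
          then have "\<bar>exp (\<phi> s + (LINT u:{s..<x}|N. k u)) - exp (\<phi> s) - (LINT u:{s..<x}|N. h u * E u)\<bar>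
              \<le> 2 * C * (measure L {s..<x})\<^sup>2 + C * measure L ({s..<x} \<inter> A)"
            using \<phi>_le[of s] \<phi>_le[of x] \<phi>_add[of s x] st \<open>a \<le> s\<close> by (intro est) auto
          also have "\<dots> \<le> b {s..<x}" using st by (intro sm) auto
          finally show ?thesis using m_add[of s x] \<phi>_add[of s x] st \<open>a \<le> s\<close> by (simp add: E)
        qed
        have right: "\<bar>m t - m x\<bar> \<le> b {x..<t}"
        proof (cases "x = t")
          case False
          then have "x < t" using st by simp
          have split: "(LINT u:{x..<v}|N. f u) = f x * measure N {x} + (LINT u:{x<..<v}|N. f u)"
            if "integrable N f" "x < v" for f :: "real \<Rightarrow> real" and v
          proof -
            have "{x..<v} = {x} \<union> {x<..<v}" using that(2) by auto
            then have "(LINT u:{x..<v}|N. f u) = (LINT u:{x}|N. f u) + (LINT u:{x<..<v}|N. f u)"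
              using that(1) by (simp only:) (rule set_integral_Un, auto intro!: integrable_imp_set_integrable)
            then show ?thesis by (simp add: integral_singleton[OF N(2)])
          qed
          \<comment> \<open>the right limit of \<open>\<phi>\<close> at \<open>x\<close>\<close>
          define p where "p = \<phi> x + k x * measure N {x}"
          have pu: "\<phi> u = p + (LINT s:{x<..<u}|N. k s)" if "x < u" for u
            using \<phi>_add[of x u] split[OF k that] that ax by (simp add: p_def)
          have p_le: "\<bar>p\<bar> \<le> \<Lambda>"
          proof -
            have "{a..x} = {a..<x} \<union> {x}" using ax by auto
            then have "(LINT u:{a..x}|N. k u) = (LINT u:{a..<x}|N. k u) + (LINT u:{x}|N. k u)"
              by (simp only:) (rule set_integral_Un, auto intro!: si)
            then have "p = (LINT u:{a..x}|N. k u)" by (simp add: p_def \<phi>_def integral_singleton[OF N(2)])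
            then show ?thesis using kL[of "{a..x}"] \<Lambda>[of "{a..x}"] by simp
          qed
          have "\<bar>\<phi> u - p\<bar> \<le> measure L {x<..<t}" if "u \<in> {x<..<t}" for u
          proof -
            have "measure L {x<..<u} \<le> measure L {x<..<t}"
              using that by (intro L.finite_measure_mono) auto
            then show ?thesis using pu[of u] kL[of "{x<..<u}"] that by auto
          qed
          then have "\<bar>exp (p + (LINT u:{x<..<t}|N. k u)) - exp p - (LINT u:{x<..<t}|N. h u * E u)\<bar>
              \<le> 2 * C * (measure L {x<..<t})\<^sup>2 + C * measure L ({x<..<t} \<inter> A)"
            using p_le \<phi>_le[of t] pu[OF \<open>x < t\<close>] by (intro est) auto
          also have "\<dots> \<le> b {x<..<t}" using st by (intro sm) auto
          also have "\<dots> \<le> b {x<..<t} + b {x}" using b_nonneg by simp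
          also have "\<dots> = b {x..<t}"
          proof -
            have "{x..<t} = {x<..<t} \<union> {x}" using \<open>x < t\<close> by auto
            then show ?thesis using b_add[of "{x<..<t}" "{x}"] by (simp only:) auto
          qed
          finally have *: "\<bar>exp (p + (LINT u:{x<..<t}|N. k u)) - exp p - (LINT u:{x<..<t}|N. h u * E u)\<bar> \<le> b {x..<t}" .
          have "exp p = E x + h x * E x * measure N {x}"
            using jump[of x] by (simp add: p_def exp_add E algebra_simps)
          then have "m t - m x = exp (p + (LINT u:{x<..<t}|N. k u)) - exp p - (LINT u:{x<..<t}|N. h u * E u)"
            using m_add[of x t] ax \<open>x < t\<close> split[OF hE \<open>x < t\<close>] pu[OF \<open>x < t\<close>] by (simp add: E)
          then show ?thesis using * by simp
        qed (use b_nonneg in simp)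
        have "{s..<t} = {s..<x} \<union> {x..<t}" using st by auto
        then have "b {s..<t} = b {s..<x} + b {x..<t}" by (simp only:) (rule b_add, auto)
        then show "\<bar>m t - m s\<bar> \<le> b {s..<t}" using left right by auto
      qed
    qed
    then have "\<bar>m T - m a\<bar> \<le> b {a..<T}" by (simp add: P_def)
    also have "\<dots> \<le> 2 * C * e * \<Lambda> + C * e"
    proof -
      have "measure L ({a..<T} \<inter> (A - F)) \<le> measure L (A - F)"
        using AF by (intro L.finite_measure_mono) auto
      then show ?thesis unfolding b_def using F(2) C \<open>e > 0\<close> \<Lambda>
        by (intro add_mono mult_left_mono) auto
    qed
    finally show ?thesis by (simp add: algebra_simps)
  qed
  have \<Lambda>0: "\<Lambda> \<ge> 0" by (simp add: \<Lambda>_def)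
  have "m T = m a"
  proof (rule ccontr)
    assume "m T \<noteq> m a"
    then have pos: "\<bar>m T - m a\<bar> > 0" by simp
    have D: "2 * C * \<Lambda> + C > 0" using \<Lambda>0 by (auto simp: C_def intro!: add_nonneg_pos mult_nonneg_nonneg)
    have "\<bar>m T - m a\<bar> \<le> (\<bar>m T - m a\<bar> / (2 * (2 * C * \<Lambda> + C))) * (2 * C * \<Lambda> + C)"
      using pos D by (intro bound) auto
    also have "\<dots> = \<bar>m T - m a\<bar> / 2" using D by (simp add: field_simps)
    finally show False using pos by simp
  qed
  moreover have "m a = 0" by (simp add: m_def E_def set_lebesgue_integral_def)
  ultimately show ?thesis by (simp add: m_def)
qed

section \<open>Variation between two points\<close>

text \<open>
  Unlike the sequences in \<open>variation_on\<close>, a chain has prescribed first and last points. Chains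
  between successive points can be concatenated, and a chain can be cut at a point.
\<close>

definition chain_sums :: "(real \<Rightarrow> real) \<Rightarrow> (real \<Rightarrow> real) \<Rightarrow> real \<Rightarrow> real \<Rightarrow> real set"
  where "chain_sums w g x y =
    {(\<Sum>j<n. w (g (p (Suc j)) - g (p j))) |n p. p 0 = x \<and> p n = y \<and> (\<forall>j<n. p j \<le> p (Suc j))}"

definition var_between :: "(real \<Rightarrow> real) \<Rightarrow> (real \<Rightarrow> real) \<Rightarrow> real \<Rightarrow> real \<Rightarrow> real"
  where "var_between w g x y = Sup (chain_sums w g x y)"

lemma chain_mono:
  fixes p :: "nat \<Rightarrow> real"
  assumes "\<forall>j<n. p j \<le> p (Suc j)" "i \<le> j" "j \<le> n"
  shows "p i \<le> p j"
  using assms(2,3)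
proof (induction j)
  case (Suc j)
  then show ?case using assms(1) by (cases "i = Suc j") (auto intro: order_trans[of "p i" "p j"])
qed simp

lemma chain_sum_concat:
  fixes w :: "real \<Rightarrow> real"
  assumes "s \<in> chain_sums w g x y" "t \<in> chain_sums w g y z"
  shows "s + t \<in> chain_sums w g x z"
proof -
  obtain n p where p: "s = (\<Sum>j<n. w (g (p (Suc j)) - g (p j)))" "p 0 = x" "p n = y" "\<forall>j<n. p j \<le> p (Suc j)"
    using assms(1) by (auto simp: chain_sums_def)
  obtain m q where q: "t = (\<Sum>j<m. w (g (q (Suc j)) - g (q j)))" "q 0 = y" "q m = z" "\<forall>j<m. q j \<le> q (Suc j)"
    using assms(2) by (auto simp: chain_sums_def)
  define r where "r j = (if j \<le> n then p j else q (j - n))" for j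
  have rn: "r (n + j) = q j" for j using p q by (cases "j = 0") (auto simp: r_def)
  have "(\<Sum>j<n + m. w (g (r (Suc j)) - g (r j))) =
      (\<Sum>j<n. w (g (r (Suc j)) - g (r j))) + (\<Sum>j<m. w (g (r (Suc (n + j))) - g (r (n + j))))"
    by (induction m) (simp_all add: add.assoc)
  also have "(\<Sum>j<n. w (g (r (Suc j)) - g (r j))) = s" unfolding p by (intro sum.cong) (auto simp: r_def)
  also have "(\<Sum>j<m. w (g (r (Suc (n + j))) - g (r (n + j)))) = t"
    using rn[of "Suc j" for j] rn unfolding q by (intro sum.cong) auto
  finally have "s + t = (\<Sum>j<n + m. w (g (r (Suc j)) - g (r j)))" by simp
  moreover have "r 0 = x" "r (n + m) = z" using p q rn[of m] by (auto simp: r_def)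
  moreover have "r j \<le> r (Suc j)" if "j < n + m" for j
  proof (cases "j < n")
    case True then show ?thesis using p by (auto simp: r_def)
  next
    case False
    then obtain i where "j = n + i" by (metis le_iff_add not_less)
    then show ?thesis using q(4) rn[of i] rn[of "Suc i"] that by auto
  qed
  ultimately show ?thesis unfolding chain_sums_def by blast
qed

lemma chain_sum_single:
  fixes w :: "real \<Rightarrow> real"
  assumes "x \<le> y"
  shows "w (g y - g x) \<in> chain_sums w g x y"
proof -
  have "w (g y - g x) = (\<Sum>j<1. w (g ((\<lambda>j. if j = 0 then x else y) (Suc j)) - g ((\<lambda>j. if j = 0 then x else y) j)))"
    by simp
  then show ?thesis unfolding chain_sums_def using assms
    by (intro CollectI exI[of _ 1] exI[of _ "\<lambda>j. if j = 0 then x else y"]) auto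
qed

text \<open>
  Subadditivity of the weight is what makes refining a chain increase its sum; it is shared by absolute
  value, positive part and negative part, so all three variations are treated at once.
\<close>

locale variation_weight =
  fixes w :: "real \<Rightarrow> real" and g :: "real \<Rightarrow> real" and a b :: real
  assumes w0: "w 0 = 0" and w_nonneg: "\<And>u. 0 \<le> w u" and w_abs: "\<And>u. w u \<le> \<bar>u\<bar>"
    and w_add: "\<And>u v. w (u + v) \<le> w u + w v" and w_cont: "\<And>u. isCont w u"
    and ab: "a \<le> b" and g: "g \<in> BV_minus a b"
begin

lemma abs_variation_finite: "variation_on abs g {a..b} < \<infinity>" and left_cont: "x \<in> {a<..b} \<Longrightarrow> (g \<longlongrightarrow> g x) (at_left x)"
  using g by (auto simp: BV_minus_def)

lemma weight_split:
  assumes "x \<le> y"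
  shows "w (g y - g x) \<le> w (g (min y z) - g (min x z)) + w (g (max y z) - g (max x z))"
  using assms w_add[of "g z - g x" "g y - g z"] w0 by (auto simp: min_def max_def)

text \<open>
  The two parts of a chain cut at \<open>z\<close> are its pointwise minimum and maximum with \<open>z\<close>.
\<close>

lemma chain_sum_split:
  assumes "s \<in> chain_sums w g x y" "x \<le> z" "z \<le> y"
  shows "\<exists>s1\<in>chain_sums w g x z. \<exists>s2\<in>chain_sums w g z y. s \<le> s1 + s2"
proof -
  obtain n p where p: "s = (\<Sum>j<n. w (g (p (Suc j)) - g (p j)))" "p 0 = x" "p n = y" "\<forall>j<n. p j \<le> p (Suc j)"
    using assms(1) by (auto simp: chain_sums_def)
  define s1 where "s1 = (\<Sum>j<n. w (g (min (p (Suc j)) z) - g (min (p j) z)))"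
  define s2 where "s2 = (\<Sum>j<n. w (g (max (p (Suc j)) z) - g (max (p j) z)))"
  have "s1 \<in> chain_sums w g x z" unfolding chain_sums_def s1_def using p assms
    by (intro CollectI exI[of _ n] exI[of _ "\<lambda>j. min (p j) z"]) (auto simp: min_le_iff_disj)
  moreover have "s2 \<in> chain_sums w g z y" unfolding chain_sums_def s2_def using p assms
    by (intro CollectI exI[of _ n] exI[of _ "\<lambda>j. max (p j) z"]) (auto simp: le_max_iff_disj)
  moreover have "s \<le> s1 + s2" unfolding p s1_def s2_def sum.distrib[symmetric]
  proof (rule sum_mono)
    fix j assume "j \<in> {..<n}"
    then have "p j \<le> p (Suc j)" using p by auto
    then show "w (g (p (Suc j)) - g (p j)) \<le> w (g (min (p (Suc j)) z) - g (min (p j) z)) +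
        w (g (max (p (Suc j)) z) - g (max (p j) z))"
      by (rule weight_split)
  qed
  ultimately show ?thesis by blast
qed

lemma chain_sum_bounded: "\<exists>B. \<forall>x y. a \<le> x \<longrightarrow> y \<le> b \<longrightarrow> (\<forall>s\<in>chain_sums w g x y. s \<le> B)"
proof -
  have "s \<le> enn2real (variation_on abs g {a..b})" if xy: "a \<le> x" "y \<le> b" "s \<in> chain_sums w g x y" for x y s
  proof -
    obtain n p where p: "s = (\<Sum>j<n. w (g (p (Suc j)) - g (p j)))" "p 0 = x" "p n = y" "\<forall>j<n. p j \<le> p (Suc j)"
      using xy(3) by (auto simp: chain_sums_def)
    have pin: "p j \<in> {a..b}" if "j \<le> n" for j
      using chain_mono[OF p(4), of 0 j] chain_mono[OF p(4), of j n] p that xy by auto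
    have "ennreal s \<le> ennreal (\<Sum>j<n. \<bar>g (p (Suc j)) - g (p j)\<bar>)" unfolding p
      by (intro ennreal_leI sum_mono w_abs)
    also have "\<dots> = (\<Sum>j<n. ennreal \<bar>g (p (Suc j)) - g (p j)\<bar>)" by (simp add: sum_ennreal)
    also have "\<dots> \<le> variation_on abs g {a..b}"
      unfolding variation_on_def using pin p(4) by (intro Sup_upper) blast
    finally show ?thesis using abs_variation_finite
      by (cases "variation_on abs g {a..b}") (auto simp: ennreal_le_iff2 intro: order_trans[OF _ enn2real_nonneg])
  qed
  then show ?thesis by blast
qed

abbreviation "V \<equiv> var_between w g"

lemma bdd: "a \<le> x \<Longrightarrow> y \<le> b \<Longrightarrow> bdd_above (chain_sums w g x y)"
  using chain_sum_bounded by (auto simp: bdd_above_def)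

lemma chain_sum_le: "a \<le> x \<Longrightarrow> y \<le> b \<Longrightarrow> s \<in> chain_sums w g x y \<Longrightarrow> s \<le> V x y"
  unfolding var_between_def by (intro cSup_upper bdd)

lemma var_least: "x \<le> y \<Longrightarrow> (\<And>s. s \<in> chain_sums w g x y \<Longrightarrow> s \<le> c) \<Longrightarrow> V x y \<le> c"
  unfolding var_between_def using chain_sum_single[of x y w g] by (intro cSup_least) auto

lemma var_approx:
  assumes "x \<le> y" "e > 0"
  shows "\<exists>s\<in>chain_sums w g x y. V x y - e < s"
  using less_cSupE[of "V x y - e" "chain_sums w g x y"] chain_sum_single[OF assms(1), of w g] assms(2)
  unfolding var_between_def by force

lemma increment_le_var: "a \<le> x \<Longrightarrow> x \<le> y \<Longrightarrow> y \<le> b \<Longrightarrow> w (g y - g x) \<le> V x y"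
  by (intro chain_sum_le chain_sum_single)

lemma var_nonneg: "a \<le> x \<Longrightarrow> x \<le> y \<Longrightarrow> y \<le> b \<Longrightarrow> 0 \<le> V x y"
  using increment_le_var w_nonneg order_trans by blast

lemma var_add:
  assumes "a \<le> x" "x \<le> y" "y \<le> z" "z \<le> b"
  shows "V x z = V x y + V y z"
proof (rule antisym)
  show "V x z \<le> V x y + V y z"
  proof (rule var_least)
    fix s assume "s \<in> chain_sums w g x z"
    then obtain s1 s2 where "s1 \<in> chain_sums w g x y" "s2 \<in> chain_sums w g y z" "s \<le> s1 + s2"
      using chain_sum_split assms by meson
    then show "s \<le> V x y + V y z" using chain_sum_le[of x y s1] chain_sum_le[of y z s2] assms by auto
  qed (use assms in auto)
  show "V x y + V y z \<le> V x z"
  proof (rule field_le_epsilon)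
    fix e :: real assume "e > 0"
    obtain s1 where s1: "s1 \<in> chain_sums w g x y" "V x y - e / 2 < s1"
      using var_approx[of x y "e / 2"] \<open>e > 0\<close> assms by auto
    obtain s2 where s2: "s2 \<in> chain_sums w g y z" "V y z - e / 2 < s2"
      using var_approx[of y z "e / 2"] \<open>e > 0\<close> assms by auto
    have "s1 + s2 \<le> V x z" using chain_sum_concat[OF s1(1) s2(1)] assms by (intro chain_sum_le) auto
    then show "V x y + V y z \<le> V x z + e" using s1 s2 by simp
  qed
qed

lemma var_self: "a \<le> x \<Longrightarrow> x \<le> b \<Longrightarrow> V x x = 0"
  using var_add[of x x x] by simp

text \<open>
  Take a nearly optimal chain from \<open>x\<close> to \<open>b\<close> and a point \<open>z\<close> before its first point beyond \<open>x\<close>. The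
  part of the chain up to \<open>z\<close> consists of the single step from \<open>x\<close> to \<open>z\<close>, and the part after it
  has a sum of at most \<open>V z b\<close>, so \<open>V x z\<close> cannot exceed that single step by more than \<open>e\<close>.
\<close>

lemma var_right_approx:
  assumes "a \<le> x" "x < b" "e > 0"
  shows "\<forall>\<^sub>F z in at_right x. V x z \<le> w (g z - g x) + e"
proof -
  obtain s where s: "s \<in> chain_sums w g x b" "V x b - e < s"
    using var_approx[of x b e] assms by auto
  obtain n p where p: "s = (\<Sum>j<n. w (g (p (Suc j)) - g (p j)))" "p 0 = x" "p n = b" "\<forall>j<n. p j \<le> p (Suc j)"
    using s by (auto simp: chain_sums_def)
  define A where "A = insert b {p j |j. j \<le> n \<and> x < p j}"
  have A: "finite A" by (auto simp: A_def)
  have Am: "x < Min A" using A assms by (auto simp: A_def Min_gr_iff)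
  have "V x z \<le> w (g z - g x) + e" if z: "x < z" "z < Min A" for z
  proof -
    have zb: "z < b" using z(2) A by (auto simp: A_def)
    have zA: "z < p j" if "j \<le> n" "x < p j" for j
      using that z(2) A by (auto simp: A_def)
    have px: "x \<le> p j" if "j \<le> n" for j using chain_mono[OF p(4), of 0 j] that p by auto
    have pc: "p j = x \<or> z < p j" if "j \<le> n" for j using px[OF that] zA[OF that] by fastforce
    define s1 where "s1 m = (\<Sum>j<m. w (g (min (p (Suc j)) z) - g (min (p j) z)))" for m
    define s2 where "s2 = (\<Sum>j<n. w (g (max (p (Suc j)) z) - g (max (p j) z)))"
    have s1m: "s1 m = (if p m = x then 0 else w (g z - g x))" if "m \<le> n" for m
      using that
    proof (induction m)
      case 0 then show ?case using p by (simp add: s1_def)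
    next
      case (Suc m)
      have "s1 (Suc m) = s1 m + w (g (min (p (Suc m)) z) - g (min (p m) z))" by (simp add: s1_def)
      moreover have "p m \<le> p (Suc m)" using p(4) Suc by auto
      ultimately show ?case using Suc pc[of m] pc[of "Suc m"] z(1) w0
        by (auto simp: min_def)
    qed
    have s2: "s2 \<in> chain_sums w g z b" unfolding chain_sums_def s2_def using p zb z
      by (intro CollectI exI[of _ n] exI[of _ "\<lambda>j. max (p j) z"]) (auto simp: le_max_iff_disj)
    have "s \<le> s1 n + s2" unfolding p s1_def s2_def sum.distrib[symmetric]
    proof (rule sum_mono)
      fix j assume "j \<in> {..<n}"
      then have "p j \<le> p (Suc j)" using p by auto
      then show "w (g (p (Suc j)) - g (p j)) \<le> w (g (min (p (Suc j)) z) - g (min (p j) z)) +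
        w (g (max (p (Suc j)) z) - g (max (p j) z))"
      by (rule weight_split)
    qed
    then have "s \<le> w (g z - g x) + V z b"
      using chain_sum_le[of z b s2] s2 s1m[of n] p assms z by auto
    then show ?thesis using var_add[of x z b] s(2) assms z zb by auto
  qed
  then show ?thesis using Am unfolding eventually_at_right_field by blast
qed

text \<open>
  The mirror image of \<open>var_right_approx\<close>, with a chain from \<open>a\<close> to \<open>y\<close> and a point \<open>z\<close> after its last
  point before \<open>y\<close>.
\<close>

lemma var_left_approx:
  assumes "a < y" "y \<le> b" "e > 0"
  shows "\<forall>\<^sub>F z in at_left y. V z y \<le> w (g y - g z) + e"
proof -
  obtain s where s: "s \<in> chain_sums w g a y" "V a y - e < s"
    using var_approx[of a y e] assms by auto
  obtain n p where p: "s = (\<Sum>j<n. w (g (p (Suc j)) - g (p j)))" "p 0 = a" "p n = y" "\<forall>j<n. p j \<le> p (Suc j)"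
    using s by (auto simp: chain_sums_def)
  define A where "A = insert a {p j |j. j \<le> n \<and> p j < y}"
  have A: "finite A" by (auto simp: A_def)
  have Am: "Max A < y" using A assms by (auto simp: A_def Max_less_iff)
  have "V z y \<le> w (g y - g z) + e" if z: "Max A < z" "z < y" for z
  proof -
    have za: "a < z" using z(1) A by (auto simp: A_def)
    have zA: "p j < z" if "j \<le> n" "p j < y" for j
      using that z(1) A by (auto simp: A_def)
    have px: "p j \<le> y" if "j \<le> n" for j using chain_mono[OF p(4), of j n] that p by auto
    have pc: "p j = y \<or> p j < z" if "j \<le> n" for j using px[OF that] zA[OF that] by fastforce
    define s2 where "s2 m = (\<Sum>j<m. w (g (max (p (Suc j)) z) - g (max (p j) z)))" for m
    define s1 where "s1 = (\<Sum>j<n. w (g (min (p (Suc j)) z) - g (min (p j) z)))"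
    have s2m: "s2 m = (if p m = y then w (g y - g z) else 0)" if "m \<le> n" for m
      using that
    proof (induction m)
      case 0 then show ?case using p assms by (simp add: s2_def)
    next
      case (Suc m)
      have "s2 (Suc m) = s2 m + w (g (max (p (Suc m)) z) - g (max (p m) z))" by (simp add: s2_def)
      moreover have "p m \<le> p (Suc m)" using p(4) Suc by auto
      ultimately show ?case using Suc pc[of m] pc[of "Suc m"] z(2) w0
        by (auto simp: max_def)
    qed
    have s1: "s1 \<in> chain_sums w g a z" unfolding chain_sums_def s1_def using p za z
      by (intro CollectI exI[of _ n] exI[of _ "\<lambda>j. min (p j) z"]) (auto simp: min_le_iff_disj)
    have "s \<le> s1 + s2 n" unfolding p s1_def s2_def sum.distrib[symmetric]
    proof (rule sum_mono)
      fix j assume "j \<in> {..<n}"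
      then have "p j \<le> p (Suc j)" using p by auto
      then show "w (g (p (Suc j)) - g (p j)) \<le> w (g (min (p (Suc j)) z) - g (min (p j) z)) +
        w (g (max (p (Suc j)) z) - g (max (p j) z))"
      by (rule weight_split)
    qed
    then have "s \<le> V a z + w (g y - g z)"
      using chain_sum_le[of a z s1] s1 s2m[of n] p assms z by auto
    then show ?thesis using var_add[of a z y] s(2) assms z za by auto
  qed
  then show ?thesis using Am unfolding eventually_at_left_field by blast
qed

lemma w_tendsto: "(f \<longlongrightarrow> l) H \<Longrightarrow> ((\<lambda>x. w (f x)) \<longlongrightarrow> w l) H"
  by (rule isCont_tendsto_compose[OF w_cont])

lemma var_left_tendsto:
  assumes "a < y" "y \<le> b"
  shows "((\<lambda>z. V z y) \<longlongrightarrow> 0) (at_left y)"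
proof (rule order_tendstoI)
  fix e :: real assume "e < 0"
  have "\<forall>\<^sub>F z in at_left y. a < z \<and> z < y"
    using assms unfolding eventually_at_left_field by blast
  then show "\<forall>\<^sub>F z in at_left y. e < V z y"
    by eventually_elim (use \<open>e < 0\<close> assms var_nonneg[of _ y] in \<open>force intro: less_le_trans\<close>)
next
  fix e :: real assume "0 < e"
  have "((\<lambda>z. w (g y - g z)) \<longlongrightarrow> w (g y - g y)) (at_left y)"
    using assms by (intro w_tendsto tendsto_intros left_cont) auto
  then have "((\<lambda>z. w (g y - g z)) \<longlongrightarrow> 0) (at_left y)" using w0 by simp
  then have "\<forall>\<^sub>F z in at_left y. w (g y - g z) < e / 2" using \<open>0 < e\<close> by (intro order_tendstoD) auto
  moreover have "\<forall>\<^sub>F z in at_left y. V z y \<le> w (g y - g z) + e / 2"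
    using assms \<open>0 < e\<close> by (intro var_left_approx) auto
  ultimately show "\<forall>\<^sub>F z in at_left y. V z y < e" by eventually_elim simp
qed

lemma var_right_tendsto:
  assumes "a \<le> x" "x < b" "(g \<longlongrightarrow> r) (at_right x)"
  shows "((\<lambda>z. V x z) \<longlongrightarrow> w (r - g x)) (at_right x)"
proof -
  have ev: "\<forall>\<^sub>F z in at_right x. x < z \<and> z < b"
    using assms unfolding eventually_at_right_field by blast
  have t: "((\<lambda>z. w (g z - g x)) \<longlongrightarrow> w (r - g x)) (at_right x)"
    by (intro w_tendsto tendsto_intros assms)
  show ?thesis
  proof (rule order_tendstoI)
    fix e assume "e < w (r - g x)"
    then have "\<forall>\<^sub>F z in at_right x. e < w (g z - g x)" using t by (intro order_tendstoD)
    with ev show "\<forall>\<^sub>F z in at_right x. e < V x z"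
      by eventually_elim (use assms increment_le_var[of x] in \<open>force intro: less_le_trans\<close>)
  next
    fix e assume "w (r - g x) < e"
    define d where "d = (e - w (r - g x)) / 2"
    have d: "d > 0" "w (r - g x) < e - d" using \<open>w (r - g x) < e\<close> by (auto simp: d_def field_simps)
    then have "\<forall>\<^sub>F z in at_right x. w (g z - g x) < e - d" using t by (intro order_tendstoD)
    moreover have "\<forall>\<^sub>F z in at_right x. V x z \<le> w (g z - g x) + d" using assms d by (intro var_right_approx)
    ultimately show "\<forall>\<^sub>F z in at_right x. V x z < e" by eventually_elim simp
  qed
qed

text \<open>
  Truncating the chain at a point \<open>z < y\<close> gives a chain in \<open>{x..<y}\<close>, and its sum converges to \<open>s\<close> as \<open>z\<close>
  approaches \<open>y\<close> because \<open>g\<close> is left continuous. Hence leaving out the right endpoint does not decrease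
  the variation.
\<close>

lemma chain_minus_endpoint:
  assumes "a \<le> x" "x < y" "y \<le> b" "s \<in> chain_sums w g x y"
  shows "ennreal s \<le> variation_on w g {x..<y}"
proof -
  obtain n p where p: "s = (\<Sum>j<n. w (g (p (Suc j)) - g (p j)))" "p 0 = x" "p n = y" "\<forall>j<n. p j \<le> p (Suc j)"
    using assms(4) by (auto simp: chain_sums_def)
  have px: "x \<le> p j \<and> p j \<le> y" if "j \<le> n" for j
    using chain_mono[OF p(4), of j n] chain_mono[OF p(4), of 0 j] that p by auto
  have lim: "((\<lambda>z. g (min (p j) z)) \<longlongrightarrow> g (p j)) (at_left y)" if "j \<le> n" for j
  proof (cases "p j = y")
    case True
    have "(g \<longlongrightarrow> g y) (at_left y)" using assms by (intro left_cont) auto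
    moreover have "\<forall>\<^sub>F z in at_left y. g z = g (min (p j) z)"
      using True by (auto simp: eventually_at_left_field intro!: exI[of _ "y - 1"])
    ultimately show ?thesis using True by (auto intro: Lim_transform_eventually)
  next
    case False
    then have "p j < y" using px[OF that] by auto
    then have "\<forall>\<^sub>F z in at_left y. g (min (p j) z) = g (p j)"
      by (auto simp: eventually_at_left_field min_def intro!: exI[of _ "p j"])
    then show ?thesis by (rule tendsto_eventually)
  qed
  have "((\<lambda>z. ennreal (\<Sum>j<n. w (g (min (p (Suc j)) z) - g (min (p j) z)))) \<longlongrightarrow> ennreal s) (at_left y)"
    unfolding p by (intro tendsto_ennrealI tendsto_sum w_tendsto tendsto_diff lim) auto
  moreover have "\<forall>\<^sub>F z in at_left y. ennreal (\<Sum>j<n. w (g (min (p (Suc j)) z) - g (min (p j) z))) \<le> variation_on w g {x..<y}"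
  proof -
    have "ennreal (\<Sum>j<n. w (g (min (p (Suc j)) z) - g (min (p j) z))) \<le> variation_on w g {x..<y}" if z: "x < z" "z < y" for z
    proof -
      have "(\<forall>j\<le>n. min (p j) z \<in> {x..<y}) \<and> (\<forall>j<n. min (p j) z \<le> min (p (Suc j)) z)"
        using px p(4) z by (auto simp: min_le_iff_disj min_less_iff_disj)
      then have "(\<Sum>j<n. ennreal (w (g (min (p (Suc j)) z) - g (min (p j) z)))) \<le> variation_on w g {x..<y}"
        unfolding variation_on_def by (intro Sup_upper CollectI exI[of _ n] exI[of _ "\<lambda>j. min (p j) z"]) simp
      then show ?thesis by (simp add: sum_ennreal w_nonneg)
    qed
    then show ?thesis using assms unfolding eventually_at_left_field by blast
  qed
  ultimately show ?thesis by (intro tendsto_upperbound[where F = "at_left y"]) auto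
qed

lemma variation_on_half_open:
  assumes "a \<le> x" "x \<le> y" "y \<le> b"
  shows "variation_on w g {x..<y} = ennreal (V x y)"
proof (cases "x = y")
  case True
  have "variation_on w g {x..<y} = 0"
    unfolding variation_on_def
  proof (intro antisym Sup_least)
    fix s
    assume "s \<in> {(\<Sum>j<n. ennreal (w (g (p (Suc j)) - g (p j)))) | (n :: nat) (p :: nat \<Rightarrow> real).
           (\<forall>j\<le>n. p j \<in> {x..<y}) \<and> (\<forall>j<n. p j \<le> p (Suc j))}"
    then obtain n :: nat and p :: "nat \<Rightarrow> real" where "\<forall>j\<le>n. p j \<in> {x..<y}" by blast
    then have "p n \<in> {x..<y}" by blast
    then show "s \<le> 0" using True by simp
  qed simp
  then show ?thesis using True var_self assms by simp
next
  case False
  then have "x < y" using assms by simp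
  show ?thesis
  proof (rule antisym)
    show "variation_on w g {x..<y} \<le> ennreal (V x y)"
      unfolding variation_on_def
    proof (rule Sup_least, clarify)
      fix n :: nat and p :: "nat \<Rightarrow> real"
      assume p: "\<forall>j\<le>n. p j \<in> {x..<y}" "\<forall>j<n. p j \<le> p (Suc j)"
      define s where "s = (\<Sum>j<n. w (g (p (Suc j)) - g (p j)))"
      have "s \<in> chain_sums w g (p 0) (p n)" using p by (auto simp: chain_sums_def s_def)
      then have "s \<le> V (p 0) (p n)" using p(1) assms by (intro chain_sum_le) (auto dest: spec[of _ 0] spec[of _ n])
      also have "\<dots> \<le> V x y"
      proof -
        have "p 0 \<le> p n" using chain_mono[OF p(2), of 0 n] by simp
        moreover have "x \<le> p 0" "p n \<le> y" using p(1) by (auto dest: spec[of _ 0] spec[of _ n])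
        ultimately show ?thesis
          using var_add[of x "p 0" y] var_add[of "p 0" "p n" y] var_nonneg[of x "p 0"] var_nonneg[of "p n" y] assms by auto
      qed
      finally show "(\<Sum>j<n. ennreal (w (g (p (Suc j)) - g (p j)))) \<le> ennreal (V x y)"
        by (simp add: s_def sum_ennreal w_nonneg ennreal_leI)
    qed
    show "ennreal (V x y) \<le> variation_on w g {x..<y}"
    proof (cases "variation_on w g {x..<y}")
      case (real r)
      then have "V x y \<le> r"
        using chain_minus_endpoint[of x y] assms \<open>x < y\<close> by (intro var_least) auto
      then show ?thesis using real by (simp add: ennreal_leI)
    qed simp
  qed
qed

end

lemma variation_weights:
  assumes "a \<le> b" "g \<in> BV_minus a b"
  shows "variation_weight abs g a b" "variation_weight pos_part g a b" "variation_weight neg_part g a b"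
  using assms by (unfold_locales; auto simp: pos_part_def[abs_def] neg_part_def[abs_def] intro!: continuous_intros)+

text \<open>
  Along every chain, the three sums determine each other up to the increment of \<open>g\<close> between the
  endpoints, so the same relations hold between the suprema. This gives the Jordan decomposition
  without an optimal chain.
\<close>

lemma chain_pos_neg:
  fixes p :: "nat \<Rightarrow> real"
  shows "(\<Sum>j<n. pos_part (g (p (Suc j)) - g (p j))) = (\<Sum>j<n. neg_part (g (p (Suc j)) - g (p j))) + (g (p n) - g (p 0))"
    and "(\<Sum>j<n. \<bar>g (p (Suc j)) - g (p j)\<bar>) = 2 * (\<Sum>j<n. neg_part (g (p (Suc j)) - g (p j))) + (g (p n) - g (p 0))"
  by (induction n; auto simp: pos_part_def neg_part_def max_def min_def)+

lemma chain_sums_pos_abs: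
  "chain_sums pos_part g x y = (\<lambda>s. s + (g y - g x)) ` chain_sums neg_part g x y"
  "chain_sums abs g x y = (\<lambda>s. 2 * s + (g y - g x)) ` chain_sums neg_part g x y"
  unfolding chain_sums_def by (auto simp: chain_pos_neg image_def; metis)+

lemma var_pos_neg:
  assumes "a \<le> b" "g \<in> BV_minus a b" "a \<le> x" "x \<le> y" "y \<le> b"
  shows "g y - g x = var_between pos_part g x y - var_between neg_part g x y"
    and "var_between abs g x y = var_between pos_part g x y + var_between neg_part g x y"
proof -
  interpret neg_var: variation_weight neg_part g a b by (rule variation_weights[OF assms(1,2)])
  interpret pos_var: variation_weight pos_part g a b by (rule variation_weights[OF assms(1,2)])
  interpret tot_var: variation_weight abs g a b by (rule variation_weights[OF assms(1,2)])
  have "var_between pos_part g x y = var_between neg_part g x y + (g y - g x)"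
  proof (rule antisym)
    show "var_between pos_part g x y \<le> var_between neg_part g x y + (g y - g x)"
      using assms neg_var.chain_sum_le[of x y] by (intro pos_var.var_least) (auto simp: chain_sums_pos_abs)
    have "var_between neg_part g x y \<le> var_between pos_part g x y - (g y - g x)"
    proof (rule neg_var.var_least)
      fix s assume "s \<in> chain_sums neg_part g x y"
      then have "s + (g y - g x) \<in> chain_sums pos_part g x y" by (simp add: chain_sums_pos_abs)
      then show "s \<le> var_between pos_part g x y - (g y - g x)" using assms pos_var.chain_sum_le by fastforce
    qed (use assms in auto)
    then show "var_between neg_part g x y + (g y - g x) \<le> var_between pos_part g x y" by simp
  qed
  moreover have "var_between abs g x y = 2 * var_between neg_part g x y + (g y - g x)"
  proof (rule antisym)
    show "var_between abs g x y \<le> 2 * var_between neg_part g x y + (g y - g x)"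
      using assms neg_var.chain_sum_le[of x y] by (intro tot_var.var_least) (auto simp: chain_sums_pos_abs)
    have "var_between neg_part g x y \<le> (var_between abs g x y - (g y - g x)) / 2"
    proof (rule neg_var.var_least)
      fix s assume "s \<in> chain_sums neg_part g x y"
      then have "2 * s + (g y - g x) \<in> chain_sums abs g x y" by (simp add: chain_sums_pos_abs)
      then show "s \<le> (var_between abs g x y - (g y - g x)) / 2" using assms tot_var.chain_sum_le by fastforce
    qed (use assms in auto)
    then show "2 * var_between neg_part g x y + (g y - g x) \<le> var_between abs g x y" by simp
  qed
  ultimately show "g y - g x = var_between pos_part g x y - var_between neg_part g x y"
    "var_between abs g x y = var_between pos_part g x y + var_between neg_part g x y" by auto
qed

lemma var_monotone:
  assumes "a \<le> b" "g \<in> BV_minus a b" "a \<le> x" "x \<le> y" "y \<le> b"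
    and "mono_on {x..y} g \<or> antimono_on {x..y} g"
  shows "var_between abs g x y = \<bar>g y - g x\<bar>"
proof -
  interpret tot_var: variation_weight abs g a b by (rule variation_weights[OF assms(1,2)])
  have "s = \<bar>g y - g x\<bar>" if s: "s \<in> chain_sums abs g x y" for s
  proof -
    obtain n p where p: "s = (\<Sum>j<n. \<bar>g (p (Suc j)) - g (p j)\<bar>)" "p 0 = x" "p n = y" "\<forall>j<n. p j \<le> p (Suc j)"
      using s by (auto simp: chain_sums_def)
    have px: "p j \<in> {x..y}" if "j \<le> n" for j
      using chain_mono[OF p(4), of j n] chain_mono[OF p(4), of 0 j] that p by auto
    show ?thesis using assms(6)
    proof
      assume m: "mono_on {x..y} g"
      have "g (p j) \<le> g (p (Suc j))" if "j < n" for j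
        using that px[of j] px[of "Suc j"] p(4) by (intro mono_onD[OF m]) auto
      then have "s = (\<Sum>j<n. g (p (Suc j)) - g (p j))" unfolding p by (intro sum.cong) auto
      also have "\<dots> = g y - g x" using p by (simp add: sum_lessThan_telescope[of "\<lambda>j. g (p j)"])
      finally show ?thesis using mono_onD[OF m, of x y] assms by simp
    next
      assume m: "antimono_on {x..y} g"
      have "g (p (Suc j)) \<le> g (p j)" if "j < n" for j
        using that px[of j] px[of "Suc j"] p(4) by (intro monotone_onD[OF m]) auto
      then have "s = (\<Sum>j<n. g (p j) - g (p (Suc j)))" unfolding p by (intro sum.cong) auto
      also have "\<dots> = g x - g y" using p by (simp add: sum_lessThan_telescope'[of "\<lambda>j. g (p j)"])
      finally show ?thesis using monotone_onD[OF m, of x y] assms by simp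
    qed
  qed
  then show ?thesis
    using tot_var.increment_le_var[of x y] assms by (intro antisym tot_var.var_least) auto
qed

text \<open>
  By the Jordan decomposition, \<open>g\<close> is a difference of monotone functions to the right of \<open>x\<close>.
\<close>

lemma right_limit_exists:
  assumes "a \<le> b" "g \<in> BV_minus a b" "a \<le> x" "x < b"
  shows "(g \<longlongrightarrow> right_lim b g x) (at_right x)"
proof -
  have lim: "\<exists>l. ((\<lambda>z. var_between w g x z) \<longlongrightarrow> l) (at_right x)" if "variation_weight w g a b" for w
  proof -
    interpret variation_weight w g a b by fact
    have "((\<lambda>z. V x z) \<longlongrightarrow> Inf (V x ` ({x<..} \<inter> {..<b}))) (at x within ({x<..} \<inter> {..<b}))"
    proof (rule Lim_right_bound)
      fix u v assume "u \<in> {..<b}" "v \<in> {..<b}" "x < u" "u \<le> v"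
      then show "V x u \<le> V x v" using var_add[of x u v] var_nonneg[of u v] assms by auto
    next
      fix u assume "u \<in> {..<b}" "x < u"
      then show "0 \<le> V x u" using var_nonneg assms by auto
    qed
    moreover have "at x within ({x<..} \<inter> {..<b}) = at_right x"
      by (rule at_within_nhd[of _ "{..<b}"]) (use assms in auto)
    ultimately show ?thesis by auto
  qed
  obtain lp ln where "((\<lambda>z. var_between pos_part g x z) \<longlongrightarrow> lp) (at_right x)"
    "((\<lambda>z. var_between neg_part g x z) \<longlongrightarrow> ln) (at_right x)"
    using lim variation_weights[OF assms(1,2)] by meson
  then have "((\<lambda>z. g x + (var_between pos_part g x z - var_between neg_part g x z)) \<longlongrightarrow> g x + (lp - ln)) (at_right x)"
    by (intro tendsto_intros)
  moreover have "\<forall>\<^sub>F z in at_right x. g x + (var_between pos_part g x z - var_between neg_part g x z) = g z"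
  proof -
    have "g x + (var_between pos_part g x z - var_between neg_part g x z) = g z" if "x < z" "z < b" for z
      using var_pos_neg(1)[OF assms(1,2), of x z] that assms by auto
    then show ?thesis using assms unfolding eventually_at_right_field by blast
  qed
  ultimately have l: "(g \<longlongrightarrow> g x + (lp - ln)) (at_right x)" by (rule Lim_transform_eventually)
  then have "Lim (at_right x) g = g x + (lp - ln)" by (intro tendsto_Lim) auto
  then show ?thesis using l assms by (simp add: right_lim_def)
qed

section \<open>The Stieltjes measures and the signed density\<close>

text \<open>
  The distribution function \<open>t \<mapsto> V a t\<close>, continued by constants outside \<open>[a, b]\<close>, is left continuous, whereas
  \<open>interval_measure\<close> assigns the increments of right continuous functions to intervals \<open>(x, y]\<close>. The two
  conventions are exchanged by reflecting the line.
\<close>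

definition stieltjes_borel :: "(real \<Rightarrow> real) \<Rightarrow> real \<Rightarrow> real \<Rightarrow> (real \<Rightarrow> real) \<Rightarrow> real measure"
  where "stieltjes_borel w a b g =
    distr (interval_measure (\<lambda>t. - var_between w g a (max a (min (- t) b)))) borel uminus"

lemma sets_stieltjes_borel[simp, measurable_cong]: "sets (stieltjes_borel w a b g) = sets borel"
  by (simp add: stieltjes_borel_def)

lemma space_stieltjes_borel[simp]: "space (stieltjes_borel w a b g) = UNIV"
  by (simp add: stieltjes_borel_def)

lemma borel_measurable_complete_AE:
  fixes u u' :: "'a \<Rightarrow> real"
  assumes "complete_measure M" "u' \<in> borel_measurable M" "AE x in M. u x = u' x"
  shows "u \<in> borel_measurable M"
proof (rule measurableI)
  interpret complete_measure M by fact
  fix A :: "real set" assume A: "A \<in> sets borel"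
  show "u -` A \<inter> space M \<in> sets M"
  proof (rule in_sets_AE)
    show "AE x in M. (x \<in> u' -` A \<inter> space M) = (x \<in> u -` A \<inter> space M)"
      using assms(3) by eventually_elim auto
    show "u' -` A \<inter> space M \<in> sets M" using assms(2) A by (rule measurable_sets)
  qed auto
qed auto

context variation_weight
begin

abbreviation "K \<equiv> stieltjes_borel w a b g"

definition "W t = V a (max a (min t b))"

lemma W_diff: "x \<le> y \<Longrightarrow> W y - W x = V (max a (min x b)) (max a (min y b))"
  unfolding W_def using var_add[of a "max a (min x b)" "max a (min y b)"] ab by auto

lemma W_mono: "x \<le> y \<Longrightarrow> W x \<le> W y"
proof -
  assume "x \<le> y"
  moreover from this have "max a (min x b) \<le> max a (min y b)" by (intro max.mono min.mono) auto
  ultimately show ?thesis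
    using W_diff[of x y] var_nonneg[of "max a (min x b)" "max a (min y b)"] ab by auto
qed

lemma W_left: "continuous (at_left y) W"
proof (cases "a < y \<and> y \<le> b")
  case True
  have "((\<lambda>z. W y - V z y) \<longlongrightarrow> W y - 0) (at_left y)"
    using True by (intro tendsto_intros var_left_tendsto) auto
  moreover have "\<forall>\<^sub>F z in at_left y. W y - V z y = W z"
  proof -
    have "W y - V z y = W z" if "a < z" "z < y" for z using W_diff[of z y] True that by auto
    then show ?thesis using True unfolding eventually_at_left_field by blast
  qed
  ultimately show ?thesis unfolding continuous_within by (auto intro: Lim_transform_eventually)
next
  case False
  have "\<exists>c<y. \<forall>z. c < z \<longrightarrow> z < y \<longrightarrow> W z = W y"
  proof (cases "y \<le> a")
    case True
    then have "W z = W y" if "z < y" for z using that by (auto simp: W_def max_def min_def)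
    then show ?thesis by (intro exI[of _ "y - 1"]) auto
  next
    case f: False
    then have "b < y" using False by auto
    moreover have "W z = W y" if "b < z" "z < y" for z using that ab by (auto simp: W_def)
    ultimately show ?thesis by blast
  qed
  then have "\<forall>\<^sub>F z in at_left y. W z = W y" unfolding eventually_at_left_field by auto
  then show ?thesis unfolding continuous_within by (rule tendsto_eventually)
qed

lemma emeasure_K: "x \<le> y \<Longrightarrow> emeasure K {x..<y} = ennreal (W y - W x)"
proof -
  assume "x \<le> y"
  let ?H = "\<lambda>t. - var_between w g a (max a (min (- t) b))"
  have H: "?H t = - W (- t)" for t by (simp add: W_def)
  have "continuous (at_right s) ?H" for s
  proof -
    have "((\<lambda>t. - W (- t)) \<longlongrightarrow> - W (- s)) (at_right s)"
    proof (intro tendsto_minus)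
      have "(W \<longlongrightarrow> W (- s)) (at_left (- s))" using W_left[of "- s"] by (simp add: continuous_within)
      then show "((\<lambda>t. W (- t)) \<longlongrightarrow> W (- s)) (at_right s)"
        by (rule filterlim_compose) (auto simp: at_left_minus[of "- s"] filterlim_def filtermap_filtermap)
    qed
    then show ?thesis by (simp add: continuous_within H)
  qed
  moreover have "?H s \<le> ?H t" if "s \<le> t" for s t using that W_mono[of "- t" "- s"] by (simp add: H)
  moreover have "uminus -` {x..<y} = {- y<..- x}" by auto
  ultimately show ?thesis
    using emeasure_interval_measure_Ioc[of "- y" "- x" ?H] \<open>x \<le> y\<close>
    by (simp add: stieltjes_borel_def emeasure_distr W_def)
qed

lemma measure_K: "x \<le> y \<Longrightarrow> measure K {x..<y} = W y - W x"
  using emeasure_K W_mono[of x y] by (simp add: measure_def)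

lemma measure_K_V: "a \<le> x \<Longrightarrow> x \<le> y \<Longrightarrow> y \<le> b \<Longrightarrow> measure K {x..<y} = V x y"
  using measure_K[of x y] W_diff[of x y] by simp

lemma finite_K: "finite_measure K"
proof
  define A where "A n = {- real n..<real n}" for n
  have "(SUP n. emeasure K (A n)) = emeasure K (\<Union>n. A n)"
    by (rule SUP_emeasure_incseq) (auto simp: A_def incseq_def)
  moreover have "(\<Union>n. A n) = UNIV"
  proof -
    have "\<exists>n. x \<in> A n" for x
    proof -
      obtain n where "\<bar>x\<bar> < real n" using reals_Archimedean2 by blast
      then show ?thesis by (intro exI[of _ n]) (auto simp: A_def)
    qed
    then show ?thesis by blast
  qed
  moreover have "emeasure K (A n) \<le> ennreal (V a b)" for n
  proof -
    have "W (real n) \<le> V a b" "0 \<le> W (- real n)"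
      using var_add[of a "max a (min (real n) b)" b] var_nonneg[of "max a (min (real n) b)" b] ab
        var_nonneg[of a "max a (min (- real n) b)"] by (auto simp: W_def)
    then show ?thesis unfolding A_def by (subst emeasure_K) (auto intro!: ennreal_leI)
  qed
  ultimately have "emeasure K UNIV \<le> ennreal (V a b)" by (metis SUP_least)
  then show "emeasure K (space K) \<noteq> \<infinity>" by (auto simp: top_unique)
qed

lemma measure_K_singleton:
  assumes "x \<in> {a..b}"
  shows "measure K {x} = w (right_lim b g x - g x)"
proof -
  interpret K: finite_measure K by (rule finite_K)
  define A where "A n = {x..<x + inverse (real (Suc n))}" for n
  have "(\<lambda>n. measure K (A n)) \<longlonglongrightarrow> measure K (\<Inter>n. A n)"
  proof (rule K.finite_Lim_measure_decseq)
    show "range A \<subseteq> sets K" by (auto simp: A_def)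
    show "decseq A"
    proof (rule decseq_SucI)
      fix n
      have "inverse (real (Suc (Suc n))) \<le> inverse (real (Suc n))" by (simp add: field_simps)
      then show "A (Suc n) \<subseteq> A n" by (auto simp: A_def)
    qed
  qed
  moreover have "(\<Inter>n. A n) = {x}"
  proof
    show "(\<Inter>n. A n) \<subseteq> {x}"
    proof
      fix y assume y: "y \<in> (\<Inter>n. A n)"
      show "y \<in> {x}"
      proof (rule ccontr)
        assume "y \<notin> {x}"
        with y have "y - x > 0" by (auto simp: A_def)
        then obtain n where "inverse (real (Suc n)) < y - x" using reals_Archimedean by blast
        moreover have "y \<in> A n" using y by blast
        ultimately show False by (simp add: A_def)
      qed
    qed
  qed (auto simp: A_def)
  ultimately have lim: "(\<lambda>n. measure K (A n)) \<longlonglongrightarrow> measure K {x}" by simp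
  show ?thesis
  proof (cases "x = b")
    case True
    have "W (x + inverse (real (Suc n))) = W x" for n
      using True ab by (simp add: W_def min_def)
    then have "measure K (A n) = 0" for n unfolding A_def by (subst measure_K) auto
    then have "measure K {x} = 0" using lim by (simp add: LIMSEQ_const_iff)
    then show ?thesis using True w0 by (simp add: right_lim_def)
  next
    case False
    then have x: "a \<le> x" "x < b" using assms by auto
    have "(\<lambda>n. x + inverse (real (Suc n))) \<longlonglongrightarrow> x + 0"
      by (intro tendsto_intros LIMSEQ_inverse_real_of_nat)
    then have "filterlim (\<lambda>n. x + inverse (real (Suc n))) (at_right x) sequentially"
      by (auto simp: filterlim_at)
    from filterlim_compose[OF var_right_tendsto[OF x right_limit_exists[OF ab g x]] this]
    have "(\<lambda>n. V x (x + inverse (real (Suc n)))) \<longlonglongrightarrow> w (right_lim b g x - g x)" .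
    moreover have "\<forall>\<^sub>F n in sequentially. V x (x + inverse (real (Suc n))) = measure K (A n)"
    proof -
      have "\<forall>\<^sub>F n in sequentially. x + inverse (real (Suc n)) < b"
        using \<open>(\<lambda>n. x + inverse (real (Suc n))) \<longlonglongrightarrow> x + 0\<close> x by (intro order_tendstoD) auto
      then show ?thesis
        by eventually_elim (use x in \<open>auto simp: A_def measure_K_V\<close>)
    qed
    ultimately have "(\<lambda>n. measure K (A n)) \<longlonglongrightarrow> w (right_lim b g x - g x)"
      by (rule Lim_transform_eventually)
    then show ?thesis using lim by (rule LIMSEQ_unique[rotated])
  qed
qed

text \<open>
  The prescribed intervals and singletons form an intersection-stable generator of the Borel sets of
  \<open>[a, b]\<close>, so the extension is unique once its existence is known from \<open>stieltjes_borel\<close>.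
\<close>

lemma stieltjes_measure_eq: "stieltjes_measure w a b g = completion (restrict_space K {a..b})"
proof -
  interpret K: finite_measure K by (rule finite_K)
  let ?I = "{(x, y). a \<le> x \<and> x \<le> y \<and> y \<le> b} <+> {a..b}"
  let ?G = "case_sum (\<lambda>(x, y). {x..<y}) (\<lambda>x. {x})"
  let ?m = "case_sum (\<lambda>(x, y). variation_on w g {x..<y}) (\<lambda>x. ennreal (w (right_lim b g x - g x)))"
  let ?R = "restrict_space K {a..b}"
  let ?M = "extend_measure {a..b} ?I ?G ?m"
  let ?E = "?G ` ?I"
  have E: "?E = {{x..<y} |x y. a \<le> x \<and> x \<le> y \<and> y \<le> b} \<union> (\<lambda>x. {x}) ` {a..b}"
  proof -
    have "?E = (\<lambda>(x, y). {x..<y}) ` {(x, y). a \<le> x \<and> x \<le> y \<and> y \<le> b} \<union> (\<lambda>x. {x}) ` {a..b}"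
      unfolding Plus_def image_Un image_image by simp
    then show ?thesis by auto
  qed
  have E_Pow: "?E \<subseteq> Pow {a..b}" unfolding E by auto
  have R: "emeasure ?R (?G i) = ?m i" if "i \<in> ?I" for i
  proof (cases i)
    case (Inl p)
    obtain x y where p: "p = (x, y)" by (cases p)
    have xy: "a \<le> x" "x \<le> y" "y \<le> b" using that Inl p by auto
    have "emeasure ?R {x..<y} = emeasure K {x..<y}" using xy by (intro emeasure_restrict_space) auto
    also have "\<dots> = ennreal (V x y)" using emeasure_K[of x y] W_diff[of x y] xy by simp
    finally show ?thesis using Inl p variation_on_half_open[OF xy] by simp
  next
    case (Inr x)
    have x: "x \<in> {a..b}" using that Inr by auto
    have "emeasure ?R {x} = emeasure K {x}" using x by (intro emeasure_restrict_space) auto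
    then show ?thesis using Inr measure_K_singleton[OF x] by (simp add: K.emeasure_eq_measure)
  qed
  have sets_R: "sets ?R = sigma_sets {a..b} ?E"
  proof
    have id: "(\<lambda>x. x) \<in> borel_measurable (sigma {a..b} ?E)"
    proof (rule borel_measurableI_less)
      fix y :: real
      have *: "{x..<z} \<in> sigma_sets {a..b} ?E" if "a \<le> x" "x \<le> z" "z \<le> b" for x z
        using that by (intro sigma_sets.Basic) (force simp: E)
      have b: "{b} \<in> sigma_sets {a..b} ?E" using ab by (intro sigma_sets.Basic) (auto simp: E)
      have "{x \<in> {a..b}. x < y} \<in> sigma_sets {a..b} ?E"
      proof (cases "y \<le> b")
        case True
        then have "{x \<in> {a..b}. x < y} = {a..<max a y}" by auto
        then show ?thesis using * True ab by simp
      next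
        case False
        then have "{x \<in> {a..b}. x < y} = {a..<b} \<union> {b}" using ab by auto
        then show ?thesis using *[of a b] b ab by (simp only: sigma_sets_Un)
      qed
      then show "{x \<in> space (sigma {a..b} ?E). x < y} \<in> sets (sigma {a..b} ?E)" using E_Pow by simp
    qed
    show "sets ?R \<subseteq> sigma_sets {a..b} ?E"
    proof
      fix S assume "S \<in> sets ?R"
      then obtain B where "B \<in> sets borel" "S = {a..b} \<inter> B" by (auto simp: sets_restrict_space)
      then show "S \<in> sigma_sets {a..b} ?E" using measurable_sets[OF id, of B] E_Pow by (simp add: Int_commute)
    qed
    have "?E \<subseteq> sets ?R" unfolding E by (auto simp: sets_restrict_space_iff)
    then show "sigma_sets {a..b} ?E \<subseteq> sets ?R"
      using sets.sigma_sets_subset[of ?E ?R] by (simp add: space_restrict_space)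
  qed
  have sets_M: "sets ?M = sigma_sets {a..b} ?E" using E_Pow by (rule sets_extend_measure)
  have M: "emeasure ?M (?G i) = ?m i" if i: "i \<in> ?I" for i
  proof (rule emeasure_extend_measure[where M = ?M and \<Omega> = "{a..b}" and I = ?I and G = ?G and \<mu> = ?m and \<mu>' = "emeasure ?R"])
    show "positive (sets ?M) (emeasure ?R)" by (simp add: positive_def)
    show "countably_additive (sets ?M) (emeasure ?R)"
      using emeasure_countably_additive[of ?R] by (simp only: sets_M sets_R)
    show "emeasure ?R (?G j) = ?m j" if "j \<in> ?I" for j using that by (rule R)
    show "?E \<subseteq> Pow {a..b}" by (rule E_Pow)
    show "i \<in> ?I" by (rule i)
  qed (rule refl)
  have MR: "emeasure ?M X = emeasure ?R X" if X: "X \<in> ?E" for X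
  proof -
    have "\<exists>i\<in>?I. X = ?G i" using X by (simp only: image_iff)
    then obtain i where i: "i \<in> ?I" "X = ?G i" by blast
    show ?thesis unfolding i(2) M[OF i(1)] R[OF i(1)] by (rule refl)
  qed
  have ab_E: "{a..<b} \<in> ?E" "{b} \<in> ?E"
  proof -
    show "{a..<b} \<in> ?E" unfolding E using ab by blast
    show "{b} \<in> ?E" unfolding E by (intro UnI2 imageI) (use ab in simp)
  qed
  have "?M = ?R"
  proof (rule measure_eqI_generator_eq_countable[where E = ?E and \<Omega> = "{a..b}" and A = "{{a..<b}, {b}}"])
    show "Int_stable ?E"
    proof (rule Int_stableI)
      have half: "{x..<y} \<in> ?E" if "a \<le> x" "y \<le> b" "x \<le> y" for x y using that unfolding E by blast
      have empty: "{} \<in> ?E" using half[of a a] ab by simp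
      fix S T assume "S \<in> ?E" "T \<in> ?E"
      then consider (hh) x y x' y' where "S = {x..<y}" "T = {x'..<y'}" "a \<le> x" "y \<le> b" "a \<le> x'" "y' \<le> b"
        | (s) x where "x \<in> {a..b}" "S = {x} \<or> T = {x}" unfolding E by blast
      then show "S \<inter> T \<in> ?E"
      proof cases
        case hh
        then have "S \<inter> T = (if max x x' \<le> min y y' then {max x x'..<min y y'} else {})" by auto
        then show ?thesis using hh half[of "max x x'" "min y y'"] empty by (auto simp del: Int_atLeastLessThan)
      next
        case s
        then have "S \<inter> T = {} \<or> S \<inter> T = {x}" by auto
        moreover have "{x} \<in> ?E" using s unfolding E by blast
        ultimately show ?thesis using empty by auto
      qed
    qed
    show "emeasure ?M X = emeasure ?R X" if "X \<in> ?E" for X using that by (rule MR)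
    show "{{a..<b}, {b}} \<subseteq> ?E" by (intro insert_subsetI ab_E empty_subsetI)
    show "emeasure ?M X \<noteq> \<infinity>" if "X \<in> {{a..<b}, {b}}" for X
    proof -
      have "X \<in> ?E" using that by (elim insertE emptyE; simp only: ab_E)
      then have "emeasure ?M X = emeasure ?R X" by (rule MR)
      also have "\<dots> = emeasure K X" using that ab by (intro emeasure_restrict_space) auto
      finally show ?thesis using K.emeasure_finite by simp
    qed
  qed (use E_Pow ab sets_M sets_R in auto)
  then show ?thesis by (simp add: stieltjes_measure_def)
qed

lemma AE_stieltjes:
  assumes "AE x in K. x \<in> {a..b} \<longrightarrow> P x"
  shows "AE x in stieltjes_measure w a b g. P x"
  unfolding stieltjes_measure_eq using assms
  by (intro AE_completion) (simp add: AE_restrict_space_iff)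

text \<open>
  A function that agrees almost everywhere with a Borel function may be replaced by it, although it is
  only measurable with respect to the completion.
\<close>

lemma stieltjes_transfer:
  fixes f f' :: "real \<Rightarrow> real"
  assumes f': "f' \<in> borel_measurable borel" "integrable K f'" and A: "A \<in> sets borel" "A \<subseteq> {a..b}"
    and ae: "AE x in K. x \<in> A \<longrightarrow> f x = f' x"
  shows "set_integrable (stieltjes_measure w a b g) A f"
    and "(LINT x:A|stieltjes_measure w a b g. f x) = (LINT x:A|K. f' x)"
proof -
  let ?R = "restrict_space K {a..b}"
  let ?u = "\<lambda>x. indicat_real A x *\<^sub>R f x" and ?u' = "\<lambda>x. indicat_real A x *\<^sub>R f' x"
  have [measurable]: "f' \<in> borel_measurable borel" "A \<in> sets borel" by fact+
  have u': "?u' \<in> borel_measurable K" by measurable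
  have u'R: "?u' \<in> borel_measurable ?R" using u' by (rule measurable_restrict_space1)
  have int: "integrable K ?u'" using f' A(1) by (intro integrable_mult_indicator) auto
  have ind: "indicat_real {a..b} x *\<^sub>R ?u' x = ?u' x" for x using A(2) by (auto simp: indicator_def)
  have intR: "integrable ?R ?u'" using int by (subst integrable_restrict_space) (simp_all only: ind, auto)
  have eqR: "integral\<^sup>L ?R ?u' = integral\<^sup>L K ?u'" by (subst integral_restrict_space) (simp_all only: ind, auto)
  have aeC: "AE x in completion ?R. ?u x = ?u' x"
  proof (rule AE_completion)
    show "AE x in ?R. ?u x = ?u' x"
      using ae by (subst AE_restrict_space_iff) (auto simp: indicator_def elim!: eventually_mono)
  qed
  have u'C: "?u' \<in> borel_measurable (completion ?R)" using u'R by (rule measurable_completion)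
  have uC: "?u \<in> borel_measurable (completion ?R)"
    by (rule borel_measurable_complete_AE[OF _ u'C aeC]) (rule completion.complete_measure_axioms)
  have "integrable (completion ?R) ?u' = integrable (completion ?R) ?u"
    using aeC uC u'C by (intro integrable_cong_AE) auto
  then show "set_integrable (stieltjes_measure w a b g) A f"
    unfolding set_integrable_def stieltjes_measure_eq using intR integrable_completion[OF u'R] by simp
  have "integral\<^sup>L (completion ?R) ?u = integral\<^sup>L (completion ?R) ?u'"
    using aeC uC u'C by (intro integral_cong_AE) auto
  also have "\<dots> = integral\<^sup>L K ?u'" using integral_completion[OF u'R] eqR by simp
  finally show "(LINT x:A|stieltjes_measure w a b g. f x) = (LINT x:A|K. f' x)"
    by (simp add: set_lebesgue_integral_def stieltjes_measure_eq)
qed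

lemma stieltjes_borel_version:
  fixes f :: "real \<Rightarrow> real"
  assumes f: "set_integrable (stieltjes_measure w a b g) A f" and A: "A \<in> sets borel" "A \<subseteq> {a..b}"
  shows "\<exists>f'. f' \<in> borel_measurable borel \<and> integrable K f' \<and> (\<forall>x. x \<notin> A \<longrightarrow> f' x = 0) \<and> (AE x in K. x \<in> A \<longrightarrow> f x = f' x)"
proof -
  let ?R = "restrict_space K {a..b}"
  let ?u = "\<lambda>x. indicat_real A x *\<^sub>R f x"
  have int: "integrable (completion ?R) ?u"
    using f by (simp add: set_integrable_def stieltjes_measure_eq)
  obtain u' where u': "u' \<in> borel_measurable ?R" "AE x in ?R. ?u x = u' x"
    using completion_ex_borel_measurable_real[OF borel_measurable_integrable[OF int]] by blast
  define f' where "f' x = indicat_real A x *\<^sub>R (indicat_real {a..b} x *\<^sub>R u' x)" for x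
  have "(\<lambda>x. indicat_real {a..b} x *\<^sub>R u' x) \<in> borel_measurable K"
    using u'(1) by (subst (asm) borel_measurable_restrict_space_iff) auto
  then have [measurable]: "(\<lambda>x. indicat_real {a..b} x *\<^sub>R u' x) \<in> borel_measurable borel"
    by (simp cong: measurable_cong_sets)
  have f'm: "f' \<in> borel_measurable borel" unfolding f'_def[abs_def] using A(1) by measurable
  have f'R: "f' \<in> borel_measurable ?R" using f'm by (intro measurable_restrict_space1) (simp cong: measurable_cong_sets)
  have ae: "AE x in ?R. f' x = ?u x"
    using u'(2) AE_space by eventually_elim (use A in \<open>auto simp: f'_def indicator_def space_restrict_space split: if_splits\<close>)
  have "integrable (completion ?R) f'"
    using int integrable_cong_AE[THEN iffD1, OF _ _ _ int, of f'] measurable_completion[OF f'R]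
      AE_completion[OF ae] borel_measurable_integrable[OF int] by (auto simp: eq_commute)
  then have "integrable ?R f'" using integrable_completion[OF f'R] by simp
  then have "integrable K (\<lambda>x. indicat_real {a..b} x *\<^sub>R f' x)" by (subst (asm) integrable_restrict_space) auto
  moreover have "(\<lambda>x. indicat_real {a..b} x *\<^sub>R f' x) = f'" by (auto simp: f'_def indicator_def)
  ultimately have "integrable K f'" by simp
  moreover have "AE x in K. x \<in> A \<longrightarrow> f x = f' x"
    using ae A by (subst (asm) AE_restrict_space_iff) (auto simp: indicator_def elim!: eventually_mono)
  moreover have "f' x = 0" if "x \<notin> A" for x using that by (simp add: f'_def)
  ultimately show ?thesis using f'm by blast
qed

end

text \<open>
  The total variation measure is the sum of the positive and the negative one, which therefore have
  densities with respect to it, and \<open>\<sigma>\<close> is the difference of these densities. Both densities lie in \<open>[0, 1]\<close> almost everywhere, and are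
  truncated so that this holds everywhere.
\<close>

lemma stieltjes_signed_density:
  assumes "a \<le> b" "g \<in> BV_minus a b"
  shows "\<exists>\<sigma> :: real \<Rightarrow> real. \<sigma> \<in> borel_measurable borel \<and> (\<forall>x. \<bar>\<sigma> x\<bar> \<le> 1) \<and>
    absolutely_continuous (stieltjes_borel abs a b g) (stieltjes_borel pos_part a b g) \<and>
    absolutely_continuous (stieltjes_borel abs a b g) (stieltjes_borel neg_part a b g) \<and>
    (\<forall>f. f \<in> borel_measurable borel \<longrightarrow> integrable (stieltjes_borel abs a b g) f \<longrightarrow>
       integrable (stieltjes_borel pos_part a b g) f \<and> integrable (stieltjes_borel neg_part a b g) f \<and>
       (\<forall>A\<in>sets borel. (LINT x:A|stieltjes_borel pos_part a b g. f x) - (LINT x:A|stieltjes_borel neg_part a b g. f x)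
          = (LINT x:A|stieltjes_borel abs a b g. f x * \<sigma> x)))"
proof -
  interpret neg_var: variation_weight neg_part g a b by (rule variation_weights[OF assms(1,2)])
  interpret pos_var: variation_weight pos_part g a b by (rule variation_weights[OF assms(1,2)])
  interpret tot_var: variation_weight abs g a b by (rule variation_weights[OF assms(1,2)])
  interpret Kt: finite_measure tot_var.K by (rule tot_var.finite_K)
  \<comment> \<open>The sum of the two measures agrees with the total variation measure on half-open intervals.\<close>
  define S where "S = measure_of UNIV (sets borel) (\<lambda>A. emeasure pos_var.K A + emeasure neg_var.K A)"
  have sets_S: "sets S = sets borel"
    unfolding S_def using sets.sigma_sets_eq[of "borel :: real measure"] by simp
  have S: "emeasure S A = emeasure pos_var.K A + emeasure neg_var.K A" if "A \<in> sets borel" for A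
  proof (rule emeasure_measure_of[OF S_def])
    show "countably_additive (sets S) (\<lambda>A. emeasure pos_var.K A + emeasure neg_var.K A)"
    proof (rule countably_additiveI)
      fix A :: "nat \<Rightarrow> real set" assume A: "range A \<subseteq> sets S" "disjoint_family A"
      have "(\<Sum>i. emeasure pos_var.K (A i) + emeasure neg_var.K (A i)) = (\<Sum>i. emeasure pos_var.K (A i)) + (\<Sum>i. emeasure neg_var.K (A i))"
        by (intro suminf_add[symmetric]) auto
      also have "\<dots> = emeasure pos_var.K (\<Union>i. A i) + emeasure neg_var.K (\<Union>i. A i)"
        using A by (simp add: suminf_emeasure sets_S)
      finally show "(\<Sum>i. emeasure pos_var.K (A i) + emeasure neg_var.K (A i)) = emeasure pos_var.K (\<Union>i. A i) + emeasure neg_var.K (\<Union>i. A i)" .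
    qed
  qed (use that sets_S in \<open>auto simp: positive_def\<close>)
  have W: "tot_var.W y - tot_var.W x = (pos_var.W y - pos_var.W x) + (neg_var.W y - neg_var.W x)" if "x \<le> y" for x y
    using var_pos_neg(2)[OF assms, of "max a (min x b)" "max a (min y b)"] that assms(1)
    by (simp add: tot_var.W_diff pos_var.W_diff neg_var.W_diff)
  have "tot_var.K = S"
  proof (rule measure_eqI_generator_eq[where E = "range (\<lambda>(a, b). {a ..< b :: real})" and \<Omega> = UNIV and A = "\<lambda>n. {- real n..<real n}"])
    show "Int_stable (range (\<lambda>(a, b). {a ..< b :: real}))"
    proof (rule Int_stableI)
      fix P Q assume "P \<in> range (\<lambda>(a, b). {a ..< b :: real})" "Q \<in> range (\<lambda>(a, b). {a ..< b :: real})"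
      then obtain u v u' v' where "P = {u..<v}" "Q = {u'..<v'}" by auto
      then have "P \<inter> Q = (\<lambda>(a, b). {a ..< b}) (max u u', min v v')" by auto
      then show "P \<inter> Q \<in> range (\<lambda>(a, b). {a ..< b :: real})" by blast
    qed
    show "sets tot_var.K = sigma_sets UNIV (range (\<lambda>(a, b). {a ..< b :: real}))"
      "sets S = sigma_sets UNIV (range (\<lambda>(a, b). {a ..< b :: real}))"
      by (simp_all add: sets_S) (simp_all add: borel_eq_atLeastLessThan)
    show "emeasure tot_var.K X = emeasure S X" if X: "X \<in> range (\<lambda>(a, b). {a ..< b :: real})" for X
    proof -
      obtain x y where Xd: "X = {x..<y}" using X by auto
      show ?thesis
      proof (cases "x \<le> y")
        case True
        then show ?thesis using W[OF True] pos_var.W_mono[OF True] neg_var.W_mono[OF True] unfolding Xd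
          by (simp add: S tot_var.emeasure_K pos_var.emeasure_K neg_var.emeasure_K ennreal_plus[symmetric] del: ennreal_plus)
      qed (simp add: Xd S)
    qed
    show "(\<Union>n. {- real n..<real n}) = UNIV"
    proof -
      have "\<exists>n. x \<in> {- real n..<real n}" for x
      proof -
        obtain n where "\<bar>x\<bar> < real n" using reals_Archimedean2 by blast
        then show ?thesis by (intro exI[of _ n]) auto
      qed
      then show ?thesis by blast
    qed
  qed auto
  then have sum: "emeasure tot_var.K A = emeasure pos_var.K A + emeasure neg_var.K A" if "A \<in> sets borel" for A using S that by simp
  have ac: "absolutely_continuous tot_var.K pos_var.K" "absolutely_continuous tot_var.K neg_var.K"
    by (auto simp: absolutely_continuous_def null_sets_def sum)
  obtain P0 where P0: "P0 \<in> borel_measurable tot_var.K" "density tot_var.K P0 = pos_var.K"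
    using Kt.Radon_Nikodym[OF ac(1)] by auto
  obtain N0 where N0: "N0 \<in> borel_measurable tot_var.K" "density tot_var.K N0 = neg_var.K"
    using Kt.Radon_Nikodym[OF ac(2)] by auto
  note [measurable] = P0(1) N0(1)
  have "density tot_var.K (\<lambda>x. P0 x + N0 x) = density tot_var.K (\<lambda>_. 1)"
  proof (rule measure_eqI)
    fix A assume A: "A \<in> sets (density tot_var.K (\<lambda>x. P0 x + N0 x))"
    then have [measurable]: "A \<in> sets borel" by simp
    have "emeasure (density tot_var.K (\<lambda>x. P0 x + N0 x)) A = (\<integral>\<^sup>+x. P0 x * indicator A x + N0 x * indicator A x \<partial>tot_var.K)"
      by (subst emeasure_density) (auto simp: distrib_right)
    also have "\<dots> = emeasure (density tot_var.K P0) A + emeasure (density tot_var.K N0) A"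
      by (subst nn_integral_add) (auto simp: emeasure_density)
    also have "\<dots> = emeasure tot_var.K A" using P0 N0 by (simp add: sum)
    finally show "emeasure (density tot_var.K (\<lambda>x. P0 x + N0 x)) A = emeasure (density tot_var.K (\<lambda>_. 1)) A"
      by (simp add: density_1)
  qed simp
  then have ae1: "AE x in tot_var.K. P0 x + N0 x = 1" by (intro Kt.density_unique) auto
  define P where "P x = min 1 (enn2real (P0 x))" for x
  define N where "N x = min 1 (enn2real (N0 x))" for x
  have PN[measurable]: "P \<in> borel_measurable borel" "N \<in> borel_measurable borel"
    using P0(1) N0(1) by (simp_all add: P_def[abs_def] N_def[abs_def] cong: measurable_cong_sets)
  have bd: "0 \<le> P x" "P x \<le> 1" "0 \<le> N x" "N x \<le> 1" for x by (auto simp: P_def N_def)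
  have le1: "ennreal (min 1 (enn2real u)) = u" if "u \<le> 1" for u
    using that by (cases u) (auto simp: min_def ennreal_le_1 top_unique)
  have Pd: "density tot_var.K (\<lambda>x. ennreal (P x)) = pos_var.K"
  proof -
    have "density tot_var.K (\<lambda>x. ennreal (P x)) = density tot_var.K P0"
    proof (rule density_cong)
      show "AE x in tot_var.K. ennreal (P x) = P0 x" using ae1
        by eventually_elim (simp add: P_def, rule le1, metis le_iff_add)
    qed measurable
    then show ?thesis using P0 by simp
  qed
  have Nd: "density tot_var.K (\<lambda>x. ennreal (N x)) = neg_var.K"
  proof -
    have "density tot_var.K (\<lambda>x. ennreal (N x)) = density tot_var.K N0"
    proof (rule density_cong)
      show "AE x in tot_var.K. ennreal (N x) = N0 x" using ae1
        by eventually_elim (simp add: N_def, rule le1, metis le_iff_add add.commute)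
    qed measurable
    then show ?thesis using N0 by simp
  qed
  define \<sigma> where "\<sigma> x = P x - N x" for x
  have \<sigma>_m: "\<sigma> \<in> borel_measurable borel" unfolding \<sigma>_def[abs_def] by measurable
  have \<sigma>_le: "\<forall>x. \<bar>\<sigma> x\<bar> \<le> 1" 
  proof
    show "\<bar>\<sigma> x\<bar> \<le> 1" for x using bd[of x] by (auto simp: \<sigma>_def)
  qed
  have main: "integrable pos_var.K f \<and> integrable neg_var.K f \<and>
       (\<forall>A\<in>sets borel. (LINT x:A|pos_var.K. f x) - (LINT x:A|neg_var.K. f x) = (LINT x:A|tot_var.K. f x * \<sigma> x))"
    if [measurable]: "f \<in> borel_measurable borel" and f: "integrable tot_var.K f" for f
  proof -
    have i: "integrable tot_var.K (\<lambda>x. P x *\<^sub>R f x)" "integrable tot_var.K (\<lambda>x. N x *\<^sub>R f x)"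
      using bd by (auto intro!: Bochner_Integration.integrable_bound[OF f] AE_I2 mult_left_le_one_le simp: abs_mult)
    have "integrable pos_var.K f" unfolding Pd[symmetric] using i bd by (subst integrable_density) auto
    moreover have "integrable neg_var.K f" unfolding Nd[symmetric] using i bd by (subst integrable_density) auto
    moreover have "(LINT x:A|pos_var.K. f x) - (LINT x:A|neg_var.K. f x) = (LINT x:A|tot_var.K. f x * \<sigma> x)" if [measurable]: "A \<in> sets borel" for A
    proof -
      have "(LINT x:A|pos_var.K. f x) = (LINT x:A|tot_var.K. P x *\<^sub>R f x)"
        unfolding Pd[symmetric] set_lebesgue_integral_def using bd
        by (subst integral_density) (auto simp: mult.left_commute)
      moreover have "(LINT x:A|neg_var.K. f x) = (LINT x:A|tot_var.K. N x *\<^sub>R f x)"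
        unfolding Nd[symmetric] set_lebesgue_integral_def using bd
        by (subst integral_density) (auto simp: mult.left_commute)
      moreover have "(LINT x:A|tot_var.K. P x *\<^sub>R f x) - (LINT x:A|tot_var.K. N x *\<^sub>R f x) = (LINT x:A|tot_var.K. P x *\<^sub>R f x - N x *\<^sub>R f x)"
        using i by (intro set_integral_diff(2)[symmetric] integrable_imp_set_integrable) auto
      ultimately show ?thesis by (simp add: \<sigma>_def algebra_simps)
    qed
    ultimately show ?thesis by blast
  qed
  show ?thesis
    by (intro exI[of _ \<sigma>] conjI[OF \<sigma>_m] conjI[OF \<sigma>_le] conjI[OF ac(1)] conjI[OF ac(2)] allI impI)
      (rule main; assumption)
qed

section \<open>The initial value problem\<close>

lemma disc_set_iff:
  assumes "a \<le> b" "g \<in> BV_minus a b"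
  shows "x \<in> disc_set a b g \<longleftrightarrow> x \<in> {a..b} \<and> right_lim b g x \<noteq> g x"
proof -
  have "left_lim a g x = g x" if x: "x \<in> {a..b}"
  proof (cases "a < x")
    case True
    then have "(g \<longlongrightarrow> g x) (at_left x)" using assms(2) x by (auto simp: BV_minus_def)
    then show ?thesis using True by (simp add: left_lim_def tendsto_Lim)
  qed (use x in \<open>simp add: left_lim_def\<close>)
  then show ?thesis by (auto simp: disc_set_def)
qed

lemma AE_atom:
  assumes "finite_measure N" "sets N = sets (borel :: real measure)" "AE x in N. P x" "measure N {x} \<noteq> 0"
  shows "P x"
proof (rule ccontr)
  interpret finite_measure N by fact
  assume "\<not> P x"
  obtain Z where Z: "{x \<in> space N. \<not> P x} \<subseteq> Z" "Z \<in> null_sets N" using assms(3) by (auto elim: AE_E simp: null_sets_def)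
  have "x \<in> Z" using Z(1) \<open>\<not> P x\<close> sets_eq_imp_space_eq[OF assms(2)] by auto
  then have "measure N {x} \<le> measure N Z" using Z(2) by (intro finite_measure_mono) auto
  also have "\<dots> = 0" using Z(2) by (auto simp: null_sets_def measure_def)
  finally show False using assms(4) by (simp add: measure_le_0_iff)
qed

text \<open>
  \<open>{t<..<y}\<close> carries little mass of the measure with density \<open>|f|\<close> when \<open>y\<close> is near \<open>t\<close>.
\<close>

lemma integral_right_limit:
  fixes f :: "real \<Rightarrow> real"
  assumes N: "finite_measure N" "sets N = sets borel" and f: "integrable N f"
  shows "((\<lambda>y. LINT s:{t..<y}|N. f s) \<longlongrightarrow> f t * measure N {t}) (at_right t)"
proof (rule tendstoI)
  fix e :: real assume "e > 0"
  have absf: "integrable N (\<lambda>s. \<bar>f s\<bar>)" using f by simp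
  define L where "L = density N (\<lambda>s. ennreal \<bar>f s\<bar>)"
  have Lf: "finite_measure L" unfolding L_def by (rule finite_measure_density_real[OF absf]) simp
  interpret L: finite_measure L by fact
  have Ls: "sets L = sets borel" by (simp add: L_def N)
  obtain d where d: "d > 0" "measure L ({t - d<..<t + d} - {t}) < e"
    using punctured_nbhd_measure_small[OF Lf Ls \<open>e > 0\<close>] by auto
  have "dist (LINT s:{t..<y}|N. f s) (f t * measure N {t}) < e" if y: "t < y" "y < t + d" for y
  proof -
    have si: "set_integrable N S f" if "S \<in> sets borel" for S
      using that N by (intro integrable_imp_set_integrable f) auto
    have "{t..<y} = {t} \<union> {t<..<y}" using y by auto
    then have "(LINT s:{t..<y}|N. f s) = (LINT s:{t}|N. f s) + (LINT s:{t<..<y}|N. f s)"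
      by (simp only:) (rule set_integral_Un, auto intro!: si)
    moreover have "\<bar>LINT s:{t<..<y}|N. f s\<bar> \<le> measure L {t<..<y}"
      using set_integral_norm_bound[OF si[of "{t<..<y}"]] finite_measure_density_real(2)[OF absf, of "{t<..<y}"] N
      by (simp add: L_def)
    moreover have "measure L {t<..<y} \<le> measure L ({t - d<..<t + d} - {t})"
      using y Ls by (intro L.finite_measure_mono) auto
    ultimately show ?thesis using d(2) integral_singleton[OF N(2), of t f] by (simp add: dist_real_def)
  qed
  then show "\<forall>\<^sub>F y in at_right t. dist (LINT s:{t..<y}|N. f s) (f t * measure N {t}) < e"
    using d(1) unfolding eventually_at_right_field by (intro exI[of _ "t + d"]) auto
qed

text \<open>
  The negative sign for \<open>y < t\<close> makes the denominator an increment of the distribution function,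
  so that one limit covers both sides.
\<close>

lemma average_imp_quotient_limit:
  fixes f G :: "real \<Rightarrow> real"
  assumes avg: "\<forall>\<eta>>0. \<exists>\<delta>>0. \<forall>l u. l < u \<and> (l = t \<or> u = t) \<and> u - l < \<delta> \<longrightarrow>
      \<bar>(LINT s:{l..<u}|N. f s) - f t * measure N {l..<u}\<bar> \<le> \<eta> * measure N {l..<u}"
    and pos: "\<forall>l u. l < u \<and> (l = t \<or> u = t) \<longrightarrow> measure N {l..<u} > 0"
    and G: "d > 0" "\<And>l u. l < u \<Longrightarrow> l = t \<or> u = t \<Longrightarrow> u - l < d \<Longrightarrow> G u - G l = (LINT s:{l..<u}|N. f s)"
  shows "((\<lambda>y. (G y - G t) / (if t < y then measure N {t..<y} else - measure N {y..<t})) \<longlongrightarrow> f t) (at t)"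
proof (rule tendstoI)
  fix e :: real assume "e > 0"
  then have "e / 2 > 0" by simp
  then obtain \<delta> where \<delta>: "\<delta> > 0" "\<And>l u. l < u \<Longrightarrow> l = t \<or> u = t \<Longrightarrow> u - l < \<delta> \<Longrightarrow>
      \<bar>(LINT s:{l..<u}|N. f s) - f t * measure N {l..<u}\<bar> \<le> (e / 2) * measure N {l..<u}"
    using avg by meson
  have quot: "\<bar>I / m - r\<bar> < e" if "\<bar>I - r * m\<bar> \<le> (e / 2) * m" "m > 0" for I m r :: real
  proof -
    have "I / m - r = (I - r * m) / m" using that by (simp add: field_simps)
    then have "\<bar>I / m - r\<bar> = \<bar>I - r * m\<bar> / m" using that by (simp add: abs_divide)
    also have "\<dots> \<le> e / 2" using that by (simp add: field_simps)
    finally show ?thesis using \<open>e > 0\<close> by simp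
  qed
  have "dist ((G y - G t) / (if t < y then measure N {t..<y} else - measure N {y..<t})) (f t) < e"
    if y: "y \<noteq> t" "dist y t < min d \<delta>" for y
  proof (cases "t < y")
    case True
    then have "\<bar>(G y - G t) / measure N {t..<y} - f t\<bar> < e"
      using y pos G(2)[of t y] \<delta>(2)[of t y] by (intro quot) (auto simp: dist_real_def)
    then show ?thesis using True by (simp add: dist_real_def)
  next
    case False
    then have "y < t" using y by simp
    then have "\<bar>(G t - G y) / measure N {y..<t} - f t\<bar> < e"
      using y pos G(2)[of y t] \<delta>(2)[of y t] by (intro quot) (auto simp: dist_real_def)
    moreover have "(G y - G t) / - measure N {y..<t} = (G t - G y) / measure N {y..<t}"
      by (metis minus_diff_eq minus_divide_divide)
    ultimately show ?thesis using False by (simp add: dist_real_def)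
  qed
  then show "\<forall>\<^sub>F y in at t. dist ((G y - G t) / (if t < y then measure N {t..<y} else - measure N {y..<t})) (f t) < e"
    using G(1) \<delta>(1) unfolding eventually_at by (intro exI[of _ "min d \<delta>"]) auto
qed

text \<open>
  By countable additivity, the integral of \<open>|u|\<close> over \<open>D\<close> is the sum of its values weighted with the masses
  of the points.
\<close>

lemma integrable_on_countable:
  fixes u :: "real \<Rightarrow> real"
  assumes N: "finite_measure N" "sets N = sets borel" and u: "u \<in> borel_measurable borel"
    and D: "countable D" and sum: "(\<lambda>x. \<bar>u x * measure N {x}\<bar>) summable_on D"
  shows "set_integrable N D u"
proof -
  interpret finite_measure N by fact
  have [measurable_cong]: "sets N = sets borel" by fact
  note [measurable] = u
  have D'[measurable]: "D \<in> sets borel" by (rule sets.countable[OF _ D]) auto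
  have "Infinite_Set_Sum.abs_summable_on (\<lambda>x. u x * measure N {x}) D"
    using sum by (simp flip: abs_summable_equivalent)
  then have fin: "(\<integral>\<^sup>+x. ennreal \<bar>u x * measure N {x}\<bar> \<partial>count_space D) < \<infinity>"
    by (simp add: abs_summable_on_def integrable_iff_bounded)
  let ?M = "density N (\<lambda>x. ennreal \<bar>u x\<bar>)"
  have pt: "emeasure ?M {x} = ennreal \<bar>u x * measure N {x}\<bar>" for x
  proof -
    have "emeasure ?M {x} = (\<integral>\<^sup>+y. ennreal \<bar>u y\<bar> * indicator {x} y \<partial>N)" by (subst emeasure_density) auto
    also have "\<dots> = (\<integral>\<^sup>+y. ennreal \<bar>u x\<bar> * indicator {x} y \<partial>N)" by (intro nn_integral_cong) (auto simp: indicator_def)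
    also have "\<dots> = ennreal \<bar>u x\<bar> * emeasure N {x}" by (rule nn_integral_cmult_indicator) (simp add: N)
    finally show ?thesis by (simp add: emeasure_eq_measure abs_mult ennreal_mult)
  qed
  have "(\<integral>\<^sup>+x. ennreal (norm (indicat_real D x *\<^sub>R u x)) \<partial>N) = (\<integral>\<^sup>+x. ennreal \<bar>u x\<bar> * indicator D x \<partial>N)"
    by (intro nn_integral_cong) (auto simp: indicator_def)
  also have "\<dots> = emeasure ?M D" by (subst emeasure_density) (auto simp: N)
  also have "\<dots> = (\<integral>\<^sup>+x. emeasure ?M {x} \<partial>count_space D)"
    by (rule emeasure_countable_singleton[OF _ D]) (simp add: N)
  also have "\<dots> < \<infinity>" using fin by (simp add: pt)
  finally show ?thesis unfolding set_integrable_def by (intro integrableI_bounded) auto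
qed

theorem theorem7p3:
  fixes a b :: real and g c :: "real \<Rightarrow> real" and F :: "real set"
  assumes "a \<le> b"
    and "g \<in> CV_minus a b"
    and "CV_witness a b g F"
    and "F \<subseteq> {a..b} - const_set a b g"
    and "g_integrable_on a b g c {a..<b}"
    and "\<forall>t\<in>{a..<b} \<inter> disc_set a b g. 1 + c t * (right_lim b g t - g t) > 0"
    and "(\<lambda>t. \<bar>ln (1 + c t * (right_lim b g t - g t))\<bar>) summable_on ({a..<b} \<inter> disc_set a b g)"
  shows
    "g_integrable_on a b g (exp_coeff a b g c) {a..<b} \<and>
     (AE t in abs_measure a b g.
        g_quotient_limit a b g (g_exp a b g c) (c t * g_exp a b g c t) t \<and>
        (t \<notin> closure (const_set a b g) - disc_set a b g \<longrightarrow>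
           has_g_derivative a b g F (g_exp a b g c) (c t * g_exp a b g c t) t)) \<and>
     g_exp a b g c a = 1 \<and>
     (\<forall>t\<in>{a..b}. g_integrable_on a b g (\<lambda>s. c s * g_exp a b g c s) {a..<t} \<and>
        g_exp a b g c t = 1 + g_integral a b g {a..<t} (\<lambda>s. c s * g_exp a b g c s))"
proof -
  have ab: "a \<le> b" by fact
  have g: "g \<in> BV_minus a b" using assms(2) by (simp add: CV_minus_def)
  interpret neg_var: variation_weight neg_part g a b by (rule variation_weights[OF ab g])
  interpret pos_var: variation_weight pos_part g a b by (rule variation_weights[OF ab g])
  interpret tot_var: variation_weight abs g a b by (rule variation_weights[OF ab g])
  let ?N = "tot_var.K"
  have fN: "finite_measure ?N" by (rule tot_var.finite_K)
  interpret N: finite_measure ?N by (rule fN)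
  have sN: "sets ?N = sets borel" by simp
  define D where "D = disc_set a b g"
  define \<Delta> where "\<Delta> x = right_lim b g x - g x" for x
  have D_iff: "x \<in> D \<longleftrightarrow> x \<in> {a..b} \<and> \<Delta> x \<noteq> 0" for x
    using disc_set_iff[OF ab g, of x] by (simp add: D_def \<Delta>_def)
  have atom: "measure ?N {x} = \<bar>\<Delta> x\<bar>" if "x \<in> {a..b}" for x
    using tot_var.measure_K_singleton[OF that] by (simp add: \<Delta>_def)
  have D_sub: "D \<subseteq> {a..<b}"
  proof
    fix x assume "x \<in> D"
    then show "x \<in> {a..<b}" by (cases "x = b") (auto simp: D_iff \<Delta>_def right_lim_def)
  qed
  have D_atom: "x \<in> D \<longleftrightarrow> x \<in> {a..b} \<and> measure ?N {x} \<noteq> 0" for x using D_iff atom by auto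
  have D_countable: "countable D"
    by (rule countable_subset[OF _ N.countable_support]) (auto simp: D_atom)
  obtain \<sigma> :: "real \<Rightarrow> real" where \<sigma>: "\<sigma> \<in> borel_measurable borel" "\<And>x. \<bar>\<sigma> x\<bar> \<le> 1"
    and ac: "absolutely_continuous ?N pos_var.K" "absolutely_continuous ?N neg_var.K"
    and dens: "\<And>f :: real \<Rightarrow> real. f \<in> borel_measurable borel \<Longrightarrow> integrable ?N f \<Longrightarrow> integrable pos_var.K f \<and> integrable neg_var.K f"
      "\<And>f A. f \<in> borel_measurable borel \<Longrightarrow> integrable ?N f \<Longrightarrow> A \<in> sets borel \<Longrightarrow>
        (LINT x:A|pos_var.K. f x) - (LINT x:A|neg_var.K. f x) = (LINT x:A|?N. f x * \<sigma> x)"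
    using stieltjes_signed_density[OF ab g] by blast
  note [measurable] = \<sigma>(1)
  have times_\<sigma>: "integrable ?N (\<lambda>x. f x * \<sigma> x)" if "integrable ?N f" for f
  proof (rule Bochner_Integration.integrable_bound[OF that])
    show "(\<lambda>x. f x * \<sigma> x) \<in> borel_measurable ?N" using borel_measurable_integrable[OF that] by measurable
    show "AE x in ?N. norm (f x * \<sigma> x) \<le> norm (f x)"
      using \<sigma>(2) by (intro AE_I2) (simp add: abs_mult mult_left_le)
  qed
  have \<sigma>_int: "integrable ?N \<sigma>" using times_\<sigma>[of "\<lambda>_. 1"] by simp
  have measure_diff: "measure pos_var.K A - measure neg_var.K A = (LINT x:A|?N. \<sigma> x)" if "A \<in> sets borel" for A
    using dens(2)[of "\<lambda>_. 1" A] that by (simp add: set_lebesgue_integral_def)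
  have \<sigma>_atom: "\<sigma> x * measure ?N {x} = \<Delta> x" if "x \<in> {a..b}" for x
  proof -
    have "\<Delta> x = measure pos_var.K {x} - measure neg_var.K {x}"
      using that by (simp add: pos_var.measure_K_singleton neg_var.measure_K_singleton \<Delta>_def pos_part_def neg_part_def max_def min_def)
    then show ?thesis using measure_diff[of "{x}"] integral_singleton[of ?N x \<sigma>] by simp
  qed
  have g_incr: "g y - g x = (LINT s:{x..<y}|?N. \<sigma> s)" if "a \<le> x" "x \<le> y" "y \<le> b" for x y
    using var_pos_neg(1)[OF ab g that] measure_diff[of "{x..<y}"] that by (simp add: pos_var.measure_K_V neg_var.measure_K_V)

  have transfer: "g_integrable_on a b g f A" "g_integral a b g A f = (LINT x:A|?N. f' x * \<sigma> x)"
    if f': "f' \<in> borel_measurable borel" "integrable ?N f'" and A: "A \<in> sets borel" "A \<subseteq> {a..b}"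
      and ae: "AE x in ?N. x \<in> A \<longrightarrow> f x = f' x" for f f' A
  proof -
    show "g_integrable_on a b g f A"
      unfolding g_integrable_on_def by (rule tot_var.stieltjes_transfer[OF f' A ae])
    have "AE x in pos_var.K. x \<in> A \<longrightarrow> f x = f' x" "AE x in neg_var.K. x \<in> A \<longrightarrow> f x = f' x"
      by (rule absolutely_continuous_AE[OF _ ac(1) ae], simp, rule absolutely_continuous_AE[OF _ ac(2) ae], simp)
    then show "g_integral a b g A f = (LINT x:A|?N. f' x * \<sigma> x)"
      unfolding g_integral_def using dens[OF f'] A
        pos_var.stieltjes_transfer(2)[OF f'(1) _ A, of f] neg_var.stieltjes_transfer(2)[OF f'(1) _ A, of f] by simp
  qed

  obtain c' where c': "c' \<in> borel_measurable borel" "integrable ?N c'" "\<And>x. x \<notin> {a..<b} \<Longrightarrow> c' x = 0"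
    "AE x in ?N. x \<in> {a..<b} \<longrightarrow> c x = c' x"
  proof -
    have "set_integrable (abs_measure a b g) {a..<b} c" "{a..<b} \<in> sets borel" "{a..<b} \<subseteq> {a..b}"
      using assms(5) by (auto simp: g_integrable_on_def)
    from tot_var.stieltjes_borel_version[OF this] show ?thesis using that by blast
  qed
  \<comment> \<open>An equality that holds almost everywhere holds at every atom.\<close>
  have c'_D: "c' x = c x" if "x \<in> D" for x
    using AE_atom[OF fN sN c'(4), of x] that D_sub D_atom by auto
  have ln_D: "1 + c x * \<Delta> x > 0" if "x \<in> D" for x using assms(6) that D_sub by (auto simp: \<Delta>_def D_def)
  define ct where "ct x = (if x \<in> D then ln (1 + c x * \<Delta> x) / \<Delta> x else c' x)" for x
  have ct_m: "ct \<in> borel_measurable borel"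
    by (rule measurable_discrete_difference[OF c'(1) D_countable]) (auto simp: ct_def)
  have D_sets: "D \<in> sets borel" by (rule sets.countable[OF _ D_countable]) auto
  have ct_int: "integrable ?N ct"
  proof -
    have "(\<lambda>x. \<bar>ct x * measure ?N {x}\<bar>) summable_on D"
    proof -
      have "(\<lambda>x. \<bar>ln (1 + c x * \<Delta> x)\<bar>) summable_on D"
        using assms(7) D_sub by (simp add: \<Delta>_def D_def inf_absorb2)
      moreover have "\<bar>ct x * measure ?N {x}\<bar> = \<bar>ln (1 + c x * \<Delta> x)\<bar>" if "x \<in> D" for x
        using that D_iff[of x] atom[of x] by (simp add: ct_def abs_mult)
      ultimately show ?thesis by (simp cong: summable_on_cong)
    qed
    from integrable_on_countable[OF fN sN ct_m D_countable this]
    have "integrable ?N (\<lambda>x. indicat_real D x *\<^sub>R ct x)" by (simp add: set_integrable_def)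
    moreover have "integrable ?N (\<lambda>x. indicat_real (- D) x *\<^sub>R c' x)"
      using D_sets by (intro integrable_mult_indicator c') auto
    ultimately have "integrable ?N (\<lambda>x. indicat_real D x *\<^sub>R ct x + indicat_real (- D) x *\<^sub>R c' x)" by simp
    also have "(\<lambda>x. indicat_real D x *\<^sub>R ct x + indicat_real (- D) x *\<^sub>R c' x) = ct"
      by (auto simp: ct_def indicator_def)
    finally show ?thesis .
  qed
  have ct_ae: "AE x in ?N. x \<in> {a..<b} \<longrightarrow> exp_coeff a b g c x = ct x"
    using c'(4) by eventually_elim (auto simp: exp_coeff_def ct_def D_def \<Delta>_def)
  define k where "k x = ct x * \<sigma> x" for x
  define h where "h x = c' x * \<sigma> x" for x
  have k_int: "integrable ?N k" and h_int: "integrable ?N h"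
    unfolding k_def[abs_def] h_def[abs_def] by (intro times_\<sigma> ct_int c')+
  define E where "E t = exp (LINT s:{a..<t}|?N. k s)" for t
  have jump: "exp (k x * measure ?N {x}) - 1 = h x * measure ?N {x}" for x
  proof (cases "x \<in> D")
    case True
    then have "x \<in> {a..b}" "\<Delta> x \<noteq> 0" by (auto simp: D_iff)
    then have "k x * measure ?N {x} = ln (1 + c x * \<Delta> x)" "h x * measure ?N {x} = c x * \<Delta> x"
      using \<sigma>_atom[of x] True c'_D[OF True] by (auto simp: k_def h_def ct_def mult.assoc)
    then show ?thesis using ln_D[OF True] by simp
  next
    case False
    then have "measure ?N {x} = 0 \<or> c' x = 0" using c'(3)[of x] D_atom[of x] by auto
    then show ?thesis using False by (auto simp: k_def h_def ct_def)
  qed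
  have E_eq: "E t = 1 + (LINT s:{a..<t}|?N. h s * E s)" if "a \<le> t" for t
    unfolding E_def
    by (rule exponential_integral_equation[OF fN sN k_int h_int D_countable _ jump that])
      (simp add: k_def h_def ct_def)
  have g_exp_E: "g_exp a b g c t = E t" if "t \<in> {a..b}" for t
  proof -
    have "AE x in ?N. x \<in> {a..<t} \<longrightarrow> exp_coeff a b g c x = ct x"
      using ct_ae by eventually_elim (use that in auto)
    then have "g_integral a b g {a..<t} (exp_coeff a b g c) = (LINT x:{a..<t}|?N. ct x * \<sigma> x)"
      using that by (intro transfer(2) ct_m ct_int) auto
    then show ?thesis by (simp add: g_exp_def E_def k_def)
  qed
  have E_m: "E \<in> borel_measurable borel"
    unfolding E_def using borel_measurable_indefinite_integral[OF sN k_int] by measurable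
  have cE_int: "integrable ?N (\<lambda>s. c' s * E s)" and hE_int: "integrable ?N (\<lambda>s. h s * E s)"
    unfolding E_def by (intro integrable_times_exponential k_int h_int c' sN)+
  have E_incr: "E y - E x = (LINT s:{x..<y}|?N. h s * E s)" if "a \<le> x" "x \<le> y" for x y
  proof -
    have "{a..<y} = {a..<x} \<union> {x..<y}" using that by auto
    then have "(LINT s:{a..<y}|?N. h s * E s) = (LINT s:{a..<x}|?N. h s * E s) + (LINT s:{x..<y}|?N. h s * E s)"
      by (simp only:) (rule set_integral_Un, auto intro!: integrable_imp_set_integrable hE_int)
    then show ?thesis using E_eq[of x] E_eq[of y] that by simp
  qed

  have int_eq: "\<forall>t\<in>{a..b}. g_integrable_on a b g (\<lambda>s. c s * g_exp a b g c s) {a..<t} \<and>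
        g_exp a b g c t = 1 + g_integral a b g {a..<t} (\<lambda>s. c s * g_exp a b g c s)"
  proof
    fix t assume t: "t \<in> {a..b}"
    have ae: "AE s in ?N. s \<in> {a..<t} \<longrightarrow> c s * g_exp a b g c s = c' s * E s"
      using c'(4) by eventually_elim (use t g_exp_E in auto)
    have m: "(\<lambda>s. c' s * E s) \<in> borel_measurable borel" using c'(1) E_m by measurable
    have A: "{a..<t} \<in> sets borel" "{a..<t} \<subseteq> {a..b}" using t by auto
    have "g_integral a b g {a..<t} (\<lambda>s. c s * g_exp a b g c s) = (LINT s:{a..<t}|?N. h s * E s)"
      using transfer(2)[OF m cE_int A ae] by (simp add: h_def mult.commute mult.left_commute)
    then show "g_integrable_on a b g (\<lambda>s. c s * g_exp a b g c s) {a..<t} \<and>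
        g_exp a b g c t = 1 + g_integral a b g {a..<t} (\<lambda>s. c s * g_exp a b g c s)"
      using transfer(1)[OF m cE_int A ae] g_exp_E[OF t] E_eq[of t] t by simp
  qed

  \<comment> \<open>At an atom the quotient of the jumps of \<open>E\<close> and \<open>g\<close> is the limit.\<close>
  have quot_D: "g_quotient_limit a b g (g_exp a b g c) (c t * g_exp a b g c t) t" if t: "t \<in> D" for t
  proof -
    have tb: "a \<le> t" "t < b" "\<Delta> t \<noteq> 0" using t D_sub D_iff by auto
    have L: "at t within {t<..b} = at_right t"
      by (rule at_within_nhd[of _ "{..<b}"]) (use tb in auto)
    have ev: "\<forall>\<^sub>F y in at_right t. t < y \<and> y < b" using tb unfolding eventually_at_right_field by blast
    have gr: "(g \<longlongrightarrow> right_lim b g t) (at_right t)" using tb by (intro right_limit_exists[OF ab g])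
    then have gd: "((\<lambda>y. g y - g t) \<longlongrightarrow> \<Delta> t) (at_right t)" unfolding \<Delta>_def by (intro tendsto_intros)
    have "\<forall>\<^sub>F y in at_right t. g y - g t \<noteq> 0" using tendsto_imp_eventually_ne[OF gd tb(3)] .
    then have ne: "\<forall>\<^sub>F y in at_right t. g y \<noteq> g t" by eventually_elim simp
    have "((\<lambda>y. LINT s:{t..<y}|?N. h s * E s) \<longlongrightarrow> h t * E t * measure ?N {t}) (at_right t)"
      by (rule integral_right_limit[OF fN sN hE_int])
    moreover have "h t * E t * measure ?N {t} = c t * E t * \<Delta> t"
      using \<sigma>_atom[of t] tb c'_D[OF t] by (simp add: h_def mult_ac)
    moreover have "\<forall>\<^sub>F y in at_right t. (LINT s:{t..<y}|?N. h s * E s) = g_exp a b g c y - g_exp a b g c t"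
      using ev by eventually_elim (use tb E_incr g_exp_E in auto)
    ultimately have "((\<lambda>y. g_exp a b g c y - g_exp a b g c t) \<longlongrightarrow> c t * E t * \<Delta> t) (at_right t)"
      by (auto intro: Lim_transform_eventually)
    from tendsto_divide[OF this gd tb(3)]
    have "((\<lambda>y. (g_exp a b g c y - g_exp a b g c t) / (g y - g t)) \<longlongrightarrow> c t * g_exp a b g c t) (at_right t)"
      using tb g_exp_E[of t] by simp
    then show ?thesis using ne t by (simp add: g_quotient_limit_def D_def L)
  qed

  \<comment> \<open>Elsewhere numerator and denominator are compared with the increments of \<open>\<mu>\<close>.\<close>
  have quot_C: "g_quotient_limit a b g (g_exp a b g c) (c t * g_exp a b g c t) t"
    if t: "a < t" "t < b" "t \<notin> D" "t \<notin> F" "c t = c' t"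
      and avg\<sigma>: "\<forall>\<eta>>0. \<exists>\<delta>>0. \<forall>l u. l < u \<and> (l = t \<or> u = t) \<and> u - l < \<delta> \<longrightarrow>
        \<bar>(LINT s:{l..<u}|?N. \<sigma> s) - \<sigma> t * measure ?N {l..<u}\<bar> \<le> \<eta> * measure ?N {l..<u}"
      and avgE: "\<forall>\<eta>>0. \<exists>\<delta>>0. \<forall>l u. l < u \<and> (l = t \<or> u = t) \<and> u - l < \<delta> \<longrightarrow>
        \<bar>(LINT s:{l..<u}|?N. h s * E s) - h t * E t * measure ?N {l..<u}\<bar> \<le> \<eta> * measure ?N {l..<u}"
      and pos: "\<forall>l u. l < u \<and> (l = t \<or> u = t) \<longrightarrow> measure ?N {l..<u} > 0" for t
  proof -
    have F: "closed F" "\<And>K. K \<in> components ({a..b} - F) \<Longrightarrow> mono_on K g \<or> antimono_on K g"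
      using assms(3) by (auto simp: CV_witness_def)
    have "open ({a<..<b} - F)" using F(1) by (intro open_Diff) auto
    moreover have "t \<in> {a<..<b} - F" using t by simp
    ultimately obtain d where d: "d > 0" "ball t d \<subseteq> {a<..<b} - F"
      by (meson open_contains_ball)
    define B where "B = ball t d"
    have B: "B \<subseteq> {a..b}" "B \<subseteq> {a..b} - F" unfolding B_def using d(2) by (rule order_trans, force)+
    have "B \<subseteq> connected_component_set ({a..b} - F) t"
      using d B by (intro connected_component_maximal) (auto simp: B_def)
    moreover have "connected_component_set ({a..b} - F) t \<in> components ({a..b} - F)"
      using t by (intro componentsI) auto
    ultimately have mono: "mono_on B g \<or> antimono_on B g"
      using F(2) by (meson mono_on_subset monotone_on_subset)
    have len: "measure ?N {l..<u} = \<bar>g u - g l\<bar>" if "l \<le> u" "l \<in> B" "u \<in> B" for l u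
    proof -
      have sub: "{l..u} \<subseteq> B" using that by (auto simp: B_def dist_real_def)
      then have "mono_on {l..u} g \<or> antimono_on {l..u} g" using mono by (meson mono_on_subset monotone_on_subset)
      then show ?thesis using that B var_monotone[OF ab g, of l u] tot_var.measure_K_V[of l u] by (auto simp: subset_eq)
    qed
    let ?n = "\<lambda>y. if t < y then measure ?N {t..<y} else - measure ?N {y..<t}"
    have lu: "a \<le> l \<and> u \<le> b" if "l < u" "l = t \<or> u = t" "u - l < d" for l u
    proof -
      have "l \<in> B" "u \<in> B" using that d(1) by (auto simp: B_def dist_real_def)
      then show ?thesis using B by auto
    qed
    have lim\<sigma>: "((\<lambda>y. (g y - g t) / ?n y) \<longlongrightarrow> \<sigma> t) (at t)"
      by (rule average_imp_quotient_limit[OF avg\<sigma> pos d(1)]) (use lu in \<open>auto intro!: g_incr\<close>)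
    have limE: "((\<lambda>y. (E y - E t) / ?n y) \<longlongrightarrow> h t * E t) (at t)"
      by (rule average_imp_quotient_limit[OF avgE pos d(1)]) (use lu in \<open>auto intro!: E_incr\<close>)
    have evB: "\<forall>\<^sub>F y in at t. y \<in> B \<and> y \<noteq> t"
      using d(1) unfolding eventually_at B_def by (intro exI[of _ d]) (auto simp: dist_commute)
    have tB: "t \<in> B" using d by (simp add: B_def)
    have abs_n: "\<bar>g y - g t\<bar> = \<bar>?n y\<bar> \<and> ?n y \<noteq> 0" if "y \<in> B" "y \<noteq> t" for y
    proof (cases "t < y")
      case True
      then show ?thesis using len[of t y] tB that pos[rule_format, of t y] by auto
    next
      case False
      then show ?thesis using len[of y t] tB that pos[rule_format, of y t] by (auto simp: abs_minus_commute)
    qed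
    have "\<forall>\<^sub>F y in at t. \<bar>(g y - g t) / ?n y\<bar> = 1"
      using evB by eventually_elim (use abs_n in \<open>simp add: abs_divide\<close>)
    then have "((\<lambda>y. \<bar>(g y - g t) / ?n y\<bar>) \<longlongrightarrow> 1) (at t)" by (rule tendsto_eventually)
    \<comment> \<open>\<open>g\<close> is monotonic near \<open>t\<close>, so its increments have the size of those of \<open>\<mu>\<close>\<close>
    then have "\<bar>\<sigma> t\<bar> = 1" using tendsto_rabs[OF lim\<sigma>] by (intro tendsto_unique[OF _ tendsto_rabs[OF lim\<sigma>]]) auto
    then have "\<sigma> t \<noteq> 0" by auto
    from tendsto_divide[OF limE lim\<sigma> this]
    have "((\<lambda>y. ((E y - E t) / ?n y) / ((g y - g t) / ?n y)) \<longlongrightarrow> h t * E t / \<sigma> t) (at t)" .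
    moreover have "h t * E t / \<sigma> t = c t * g_exp a b g c t"
      using \<open>\<sigma> t \<noteq> 0\<close> t g_exp_E[of t] by (simp add: h_def)
    moreover have "\<forall>\<^sub>F y in at t. ((E y - E t) / ?n y) / ((g y - g t) / ?n y) =
        (g_exp a b g c y - g_exp a b g c t) / (g y - g t)"
      using evB
    proof eventually_elim
      case (elim y)
      then have n: "?n y \<noteq> 0" using abs_n by blast
      have cancel: "(A / m) / (B / m) = A / B" if "m \<noteq> 0" for A B m :: real using that by simp
      have "y \<in> {a..b}" "t \<in> {a..b}" using elim tB B by blast+
      then show ?case by (simp only: g_exp_E cancel[OF n])
    qed
    ultimately have "((\<lambda>y. (g_exp a b g c y - g_exp a b g c t) / (g y - g t)) \<longlongrightarrow> c t * g_exp a b g c t) (at t)"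
      by (auto intro: Lim_transform_eventually)
    moreover have "\<forall>\<^sub>F y in at t. g y \<noteq> g t"
      using evB by eventually_elim (use abs_n in force)
    moreover have "at t within {a..b} = at t" using t by (intro at_within_interior) (simp add: interior_atLeastAtMost_real)
    ultimately show ?thesis using t(3) by (simp add: g_quotient_limit_def D_def)
  qed

  have ne: "AE t in ?N. measure ?N {z} = 0 \<longrightarrow> t \<noteq> z" for z
  proof (cases "measure ?N {z} = 0")
    case True
    then have "{z} \<in> null_sets ?N" by (simp add: null_sets_def N.emeasure_eq_measure)
    from AE_not_in[OF this] show ?thesis by eventually_elim simp
  qed simp
  have quot: "AE t in ?N. t \<in> {a..b} \<longrightarrow> t \<notin> F - D \<longrightarrow>
      g_quotient_limit a b g (g_exp a b g c) (c t * g_exp a b g c t) t"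
    using AE_average_tendsto[OF fN sN \<sigma>_int] AE_average_tendsto[OF fN sN hE_int]
      AE_measure_interval_pos[OF fN sN] c'(4) ne[of a] ne[of b]
  proof eventually_elim
    case (elim t)
    show ?case
    proof (intro impI, cases "t \<in> D")
      case True
      then show "g_quotient_limit a b g (g_exp a b g c) (c t * g_exp a b g c t) t" by (rule quot_D)
    next
      case False
      assume t: "t \<in> {a..b}" "t \<notin> F - D"
      then have t0: "measure ?N {t} = 0" using False D_atom by auto
      then have "a < t" "t < b" using t elim by (auto simp: less_le)
      then show "g_quotient_limit a b g (g_exp a b g c) (c t * g_exp a b g c t) t"
        using False t t0 elim by (intro quot_C) auto
    qed
  qed
  have "F - D \<in> null_sets (abs_measure a b g)" using assms(3) by (simp add: CV_witness_def D_def)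
  then have "AE t in abs_measure a b g. t \<notin> F - D" by (rule AE_not_in)
  moreover have "AE t in abs_measure a b g. t \<notin> F - D \<longrightarrow>
      g_quotient_limit a b g (g_exp a b g c) (c t * g_exp a b g c t) t"
    by (rule tot_var.AE_stieltjes[OF quot])
  moreover have "AE t in abs_measure a b g. t \<in> {a..b}"
    by (rule tot_var.AE_stieltjes) simp
  ultimately have "AE t in abs_measure a b g.
        g_quotient_limit a b g (g_exp a b g c) (c t * g_exp a b g c t) t \<and>
        (t \<notin> closure (const_set a b g) - disc_set a b g \<longrightarrow>
           has_g_derivative a b g F (g_exp a b g c) (c t * g_exp a b g c t) t)"
    by eventually_elim (auto simp: has_g_derivative_def g_derivative_domain_def D_def)
  moreover have "g_integrable_on a b g (exp_coeff a b g c) {a..<b}"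
    using ct_ae by (intro transfer(1)[OF ct_m ct_int]) auto
  moreover have "g_exp a b g c a = 1"
    using g_exp_E[of a] ab by (simp add: E_def set_lebesgue_integral_def)
  ultimately show ?thesis using int_eq by blast
qed

end
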